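(* Let $x\in\mathbb{C}'=\mathbb{C}\setminus(-\infty,0]$. (1) For $u,v\in\mathbb{D}'$, $$\mathscr{F}(x;u,v)+\mathscr{F}\left(\frac1x;v,u\right)=-\log(1-u)\log(1-v).$$ (2) For $u,v,uv\in\mathbb{D}'$, $$\begin{aligned}&\mathscr{F}(x;u,v)-\mathscr{F}(x+1;uv,v)-\mathscr{F}\left(\frac{x}{x+1};u,uv\right)\\ &=\log(1-u)\log(1-uv)+\mathrm{Li}_2(u)-\mathrm{Li}_2\left(\frac{v}{v-1}\right)+2\,\mathrm{Li}_2\left(\frac{u}{u-1}\right)-\mathrm{Li}_2\left(\frac{u-v}{1-v}\right)\\ &\quad-\left(\frac{1}{x+1}-\frac12\right)\mathrm{Li}_2(uv)-\sum_{j=1}^2\left\{\mathrm{Li}_2\left(\frac{u+\sqrt{uv}\,e^{\pi i j}}{u-1}\right)-\mathrm{Li}_2\left(\frac{v+\sqrt{uv}\,e^{\pi i j}}{v-1}\right)\right\}.\end{aligned}$$ (3) For $u,v\in\mathbb{D}_1'$ with $uv\neq1$, $$\begin{aligned}&\mathscr{F}(x;u,v)+\mathscr{F}(x;u^{-1},v^{-1})-\mathscr{F}(x+1;uv,v)-\mathscr{F}\left(x+1;(uv)^{-1},v^{-1}\right)\\ &\quad-\mathscr{F}\left(\frac{x}{x+1};u,uv\right)-\mathscr{F}\left(\frac{x}{x+1};u^{-1},(uv)^{-1}\right)\\ &=\log(1-u)\log(1-uv)+\log(1-u^{-1})\log\left(1-(uv)^{-1}\right)+2\log\left(\frac{u}{u-1}\right)\log(1-u)\\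 &\quad-\frac12\log^2(-u)-\log\left(\frac{v}{v-1}\right)\log(1-v)+\left(\frac{1}{x+1}-\frac12\right)\left(\frac12\log^2(-uv)+\frac{\pi^2}{6}\right)\\ &\quad-\mathrm{Li}_2\left(\frac{u-v}{1-v}\right)-\mathrm{Li}_2\left(\frac{u-v}{u(1-v)}\right)\\ &\quad-\sum_{j=1}^2\left\{\mathrm{Li}_2\left(\frac{u+\sqrt{uv}\,e^{\pi ij}}{u-1}\right)-\mathrm{Li}_2\left(\frac{v+\sqrt{uv}\,e^{\pi ij}}{v-1}\right)+\mathrm{Li}_2\left(\frac{1+\sqrt{uv^{-1}}\,e^{\pi ij}}{1-u}\right)-\mathrm{Li}_2\left(\frac{1+\sqrt{vu^{-1}}\,e^{\pi ij}}{1-v}\right)\right\}.\end{aligned}$$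
   Context: $\mathbb{D}=\{z\in\mathbb{C}\setminus\{0\}:|z|\le1\}$, $\mathbb{D}'=\mathbb{D}\setminus\{1\}$, $\mathbb{D}_1=\{z\in\mathbb{C}:|z|=1\}$, $\mathbb{D}_1'=\mathbb{D}_1\setminus\{1\}$. The Herglotz-Zagier-Novikov function is defined, for $\mathrm{Re}(x)>0$, $u\in\mathbb{C}\setminus(1,\infty)$, $u\ne0$, and $v\in\mathbb{C}\setminus[1,\infty)$, $v\neq0$, by $$\mathscr{F}(x;u,v)=\int_0^1\frac{\log(1-ut^x)}{v^{-1}-t}\,dt.$$ For $|u|,|v|\le 1$ as in the claim and $x\in\mathbb{C}'$, $\mathscr{F}(x;u,v)$ denotes the analytic continuation in $x$ of this integral from $\mathrm{Re}(x)>0$ to $\mathbb{C}'$; when $|u|<1$ and $|v|<1$ it is given by $\mathscr{F}(x;u,v)=-\sum_{m,n\ge1}\frac{u^mv^n}{m(mx+n)}$. Logarithms are principal. $\mathrm{Li}_2(z)=\sum_{n\ge1}z^n/n^2$ for $|z|\le 1$, extended analytically to $\mathbb{C}\setminus[1,\infty)$ (principal branch), with $\mathrm{Li}_2(1)=\pi^2/6$. Each square root may be any fixed square root, since the sums over $j=1,2$ run over both signs. *)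

theory Defs
  imports "HOL-Analysis.Analysis"
begin

text \<open>
  The holomorphic function on \<open>B\<close> that agrees with \<open>f\<close> on \<open>A\<close>. The choice operator is needed
  because values outside \<open>B\<close> are arbitrary. On \<open>B\<close> the function is unique, provided that it exists,
  when \<open>B\<close> is open and connected and \<open>A\<close> is a nonempty open subset of \<open>B\<close>, as in both uses below.
\<close>

definition continuation :: "complex set \<Rightarrow> complex set \<Rightarrow> (complex \<Rightarrow> complex) \<Rightarrow> complex \<Rightarrow> complex"
  where "continuation A B f = (SOME g. g holomorphic_on B \<and> (\<forall>z\<in>A. g z = f z))"

definition slit_plane :: "complex set"
  where "slit_plane = - complex_of_real ` {..0}"

definition punctured_disc :: "complex set"
  where "punctured_disc = {z. z \<noteq> 0 \<and> norm z \<le> 1}"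

definition punctured_disc' :: "complex set"
  where "punctured_disc' = punctured_disc - {1}"

definition unit_circle :: "complex set"
  where "unit_circle = {z. norm z = 1}"

definition unit_circle' :: "complex set"
  where "unit_circle' = unit_circle - {1}"

definition Li2_series :: "complex \<Rightarrow> complex"
  where "Li2_series z = (\<Sum>n. z ^ Suc n / of_nat (Suc n) ^ 2)"

text \<open>Values on the cut \<open>(1,\<infinity>)\<close> are not meaningful.\<close>

definition Li2 :: "complex \<Rightarrow> complex"
  where "Li2 z = (if norm z \<le> 1 then Li2_series z
    else continuation (ball 0 1) (- complex_of_real ` {1..}) Li2_series z)"

definition HZN_integral :: "complex \<Rightarrow> complex \<Rightarrow> complex \<Rightarrow> complex"
  where "HZN_integral x u v =
    integral {0..1} (\<lambda>t::real. ln (1 - u * of_real t powr x) / (inverse v - of_real t))"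

text \<open>
  The Herglotz-Zagier-Novikov function, continued in \<open>x\<close> with \<open>u\<close> and \<open>v\<close> held fixed; intended for
  \<open>u\<close> and \<open>v\<close> in the punctured closed unit disc with \<open>v \<noteq> 1\<close>.
\<close>

definition HZN :: "complex \<Rightarrow> complex \<Rightarrow> complex \<Rightarrow> complex"
  where "HZN x u v = continuation {x. Re x > 0} slit_plane (\<lambda>x. HZN_integral x u v) x"

end

theory Submission
  imports Defs "HOL-Complex_Analysis.Complex_Analysis" "HOL-Real_Asymp.Real_Asymp"
begin

text \<open>
  Inside the open bidisc, \<open>- F(x; u, v)\<close> is the double series \<open>D\<close> of
  \<open>u\<^sup>m v\<^sup>n / (m (m x + n))\<close> over \<open>m, n \<ge> 1\<close>, and the functional equations come from
  relations between its coefficients. For the first identity, the terms of \<open>D(x; u, v)\<close> at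
  \<open>(m, n)\<close> and of \<open>D(1/x; v, u)\<close> at \<open>(n, m)\<close> add up to \<open>(u\<^sup>m / m) (v\<^sup>n / n)\<close>, so
  the double sum factorises into logarithms (\<open>double_series_reflection\<close>). For the second, the
  index set is split into \<open>m < n\<close>, \<open>m = n\<close> and \<open>m > n\<close>. The first part is
  \<open>D(x + 1; u v, v)\<close>, the diagonal is \<open>Li\<^sub>2(u v) / (x + 1)\<close>, and a partial fraction
  turns the last part into \<open>D(x / (x + 1); u, u v) - D(1; u, u v)\<close> (\<open>double_series_three_term\<close>).
  Only the term at \<open>x = 1\<close> is left to be evaluated. There the power in the integrand is \<open>t\<close> itself,
  and an explicit primitive expresses it through dilogarithms (\<open>HZN_integral_at_1\<close>). The square
  roots enter through \<open>dilog_square_root_identity\<close>, which is proved by scaling \<open>u, v, s\<close> by \<open>r\<close> and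
  checking that the derivative in \<open>r\<close> vanishes.

  On the boundary of the bidisc the double series no longer converges absolutely. One summation by
  parts in \<open>n\<close> (\<open>abel_series\<close>) gains a factor \<open>1 / (m x + n + 1)\<close> at the price of a denominator
  \<open>1 - v\<close>. The new series converges uniformly in \<open>(u, v)\<close> on the closed bidisc and locally uniformly
  in \<open>x\<close> on the slit plane. It is therefore the analytic continuation of the integral
  (\<open>HZN_eq_abel_series\<close>), and it carries every identity from \<open>(r u, r v)\<close>, \<open>r < 1\<close>, to the limit
  \<open>r = 1\<close>.

  The third identity is the sum of the second at \<open>(u, v, s)\<close> and at \<open>(1/u, 1/v, p/u)\<close>. The
  values of \<open>Li\<^sub>2\<close> at \<open>u, 1/u\<close> and at \<open>u v, 1/(u v)\<close> are combined by the inversion formula,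
  those at \<open>v / (v - 1)\<close> and \<open>1 / (1 - v)\<close>, which add up to \<open>1\<close>, by the reflection formula,
  and likewise with \<open>u\<close> in place of \<open>v\<close>.
\<close>

section \<open>The slit plane and the dilogarithm\<close>

text \<open>
  By the identity theorem the choice in the definition does not matter: any explicit
  continuation computes it.
\<close>

lemma continuation_eq:
  assumes "open A" "A \<noteq> {}" "A \<subseteq> B" "open B" "connected B"
    and "g holomorphic_on B" "\<And>z. z \<in> A \<Longrightarrow> g z = f z" "z \<in> B"
  shows "continuation A B f z = g z"
proof -
  let ?P = "\<lambda>h. h holomorphic_on B \<and> (\<forall>z\<in>A. h z = f z)"
  have "?P g" using assms(6,7) by blast
  then have P: "?P (continuation A B f)"
    unfolding continuation_def by (rule someI[of ?P g])
  have "continuation A B f w = g w" if "w \<in> A" for w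
    using P assms(7)[OF that] that by metis
  with P show ?thesis
    using analytic_continuation_open[OF assms(1,4,2,5,3) _ assms(6) _ assms(8)] by blast
qed

lemma slit_plane_iff: "z \<in> slit_plane \<longleftrightarrow> z \<notin> \<real>\<^sub>\<le>\<^sub>0"
  by (auto simp: slit_plane_def nonpos_Reals_def image_def)

lemma open_slit_plane: "open slit_plane"
proof -
  have "slit_plane = - \<real>\<^sub>\<le>\<^sub>0" by (auto simp: slit_plane_iff)
  then show ?thesis using closed_nonpos_Reals_complex by (metis open_Compl)
qed

lemma connected_slit_plane: "connected slit_plane"
  unfolding slit_plane_def
  by (intro starlike_imp_connected starlike_slotted_complex_plane_left)

lemma right_half_plane_subset_slit_plane: "{z. Re z > 0} \<subseteq> slit_plane"
  by (auto simp: slit_plane_iff nonpos_Reals_def)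

lemma slit_plane_add_1: "x \<in> slit_plane \<Longrightarrow> x + 1 \<in> slit_plane"
  by (auto simp: slit_plane_iff complex_nonpos_Reals_iff)

lemma slit_plane_inverse: "x \<in> slit_plane \<Longrightarrow> inverse x \<in> slit_plane"
  by (simp add: slit_plane_iff)

lemma slit_plane_moebius:
  assumes "x \<in> slit_plane"
  shows "x / (x + 1) \<in> slit_plane"
proof -
  have "x \<noteq> 0" "x + 1 \<noteq> 0"
    using assms slit_plane_add_1[OF assms] by (auto simp: slit_plane_iff)
  then have "x / (x + 1) = inverse (inverse x + 1)" by (simp add: field_simps)
  then show ?thesis by (simp only: assms slit_plane_inverse slit_plane_add_1)
qed

definition dilog_domain :: "complex set"
  where "dilog_domain = - complex_of_real ` {1..}"

lemma dilog_domain_iff: "z \<in> dilog_domain \<longleftrightarrow> 1 - z \<in> slit_plane"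
proof -
  have "z \<in> complex_of_real ` {1..} \<longleftrightarrow> 1 - z \<in> complex_of_real ` {..0}"
  proof
    assume "z \<in> complex_of_real ` {1..}"
    then obtain t where "z = of_real t" "t \<ge> 1" by auto
    then show "1 - z \<in> complex_of_real ` {..0}"
      by (intro image_eqI[of _ _ "1 - t"]) auto
  next
    assume "1 - z \<in> complex_of_real ` {..0}"
    then obtain t where t: "1 - z = of_real t" "t \<le> 0" by auto
    then have "z = of_real (1 - t)" by (simp add: algebra_simps)
    then show "z \<in> complex_of_real ` {1..}"
      using t by (intro image_eqI[of _ _ "1 - t"]) auto
  qed
  then show ?thesis by (auto simp: dilog_domain_def slit_plane_def)
qed

lemma open_dilog_domain: "open dilog_domain"
proof -
  have "dilog_domain = (\<lambda>z. 1 - z) -` slit_plane"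
    by (auto simp: dilog_domain_iff)
  moreover have "open ((\<lambda>z. 1 - z) -` slit_plane)"
    by (intro continuous_open_vimage open_slit_plane continuous_intros)
  ultimately show ?thesis by metis
qed

lemma starlike_dilog_domain: "starlike dilog_domain"
  unfolding dilog_domain_def by (rule starlike_slotted_complex_plane_right)

lemma Re_less_1_in_dilog_domain: "Re z < 1 \<Longrightarrow> z \<in> dilog_domain"
  by (simp add: dilog_domain_iff slit_plane_iff complex_nonpos_Reals_iff)

lemma closed_disc_minus_1_dilog_domain: "norm z \<le> 1 \<Longrightarrow> z \<noteq> 1 \<Longrightarrow> z \<in> dilog_domain"
  by (auto simp: dilog_domain_def)

text \<open>
  The majorant \<open>1 / n\<^sup>2\<close> works on the whole closed disc, so the series stays continuous up to
  the boundary.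
\<close>

lemma Li2_series_uniform_limit:
  "uniform_limit (cball 0 1) (\<lambda>N z. \<Sum>n<N. z ^ Suc n / of_nat (Suc n) ^ 2)
     Li2_series sequentially"
proof -
  have "summable (\<lambda>n. 1 / real (Suc n) ^ 2)"
    using inverse_squares_sums by (simp add: sums_iff add_ac)
  moreover have "norm (z ^ Suc n / of_nat (Suc n) ^ 2) \<le> 1 / real (Suc n) ^ 2"
    if "z \<in> cball 0 1" for n and z :: complex
    using that by (auto simp: norm_divide norm_power power_le_one divide_simps simp del: power_Suc of_nat_Suc)
  ultimately show ?thesis
    unfolding Li2_series_def by (intro Weierstrass_m_test) auto
qed

lemma Li2_series_sums:
  assumes "norm z \<le> 1"
  shows "(\<lambda>n. z ^ Suc n / of_nat (Suc n) ^ 2) sums Li2_series z"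
  using tendsto_uniform_limitI[OF Li2_series_uniform_limit, of z] assms
  by (simp add: sums_def)

lemma continuous_on_Li2_series: "continuous_on (cball 0 1) Li2_series"
  by (rule uniform_limit_theorem[OF _ Li2_series_uniform_limit])
     (auto intro!: always_eventually continuous_intros simp del: of_nat_Suc)

definition dilog_deriv :: "complex \<Rightarrow> complex"
  where "dilog_deriv z = (if z = 0 then 1 else - ln (1 - z) / z)"

lemma dilog_deriv_sums:
  assumes "norm z < 1"
  shows "(\<lambda>n. z ^ n / of_nat (Suc n)) sums dilog_deriv z"
proof (cases "z = 0")
  case True
  then show ?thesis using powser_sums_zero[of "\<lambda>n. 1 / of_nat (Suc n) :: complex"]
    by (simp add: dilog_deriv_def)
next
  case False
  have "(\<lambda>n. - (z ^ n) / of_nat n) sums ln (1 - z)"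
    using Ln_series'[of "-z"] assms by simp
  then have "(\<lambda>n. - (z ^ Suc n) / of_nat (Suc n)) sums ln (1 - z)"
    by (subst sums_Suc_iff) simp
  from sums_mult[OF this, of "- inverse z"] False show ?thesis
    by (simp add: dilog_deriv_def field_simps)
qed

lemma Li2_series_has_derivative:
  assumes "norm z < 1"
  shows "(Li2_series has_field_derivative dilog_deriv z) (at z)"
proof -
  let ?c = "\<lambda>n. 1 / of_nat n ^ 2 :: complex"
  have sm: "(\<lambda>n. ?c n * w ^ n) sums Li2_series w" if "norm w < 1" for w
    using Li2_series_sums[of w] that sums_Suc_iff[of "\<lambda>n. ?c n * w ^ n"] by simp
  have "((\<lambda>w. \<Sum>n. ?c n * w ^ n) has_field_derivative (\<Sum>n. diffs ?c n * z ^ n)) (at z)"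
    by (rule termdiffs_strong'[of 1]) (use sm assms in \<open>auto simp: sums_iff\<close>)
  also have "(\<lambda>n. diffs ?c n * z ^ n) = (\<lambda>n. z ^ n / of_nat (Suc n))"
    by (auto simp: diffs_def power2_eq_square fun_eq_iff simp del: of_nat_Suc)
  also have "(\<Sum>n. z ^ n / of_nat (Suc n)) = dilog_deriv z"
    using dilog_deriv_sums[OF assms] by (simp add: sums_iff)
  finally show ?thesis
    by (rule has_field_derivative_transform_within_open[of _ _ _ "ball 0 1"])
       (use assms sm in \<open>auto simp: sums_iff\<close>)
qed

text \<open>
  The singularity at 0 is removable, because near 0 the function is the sum of a power series.
\<close>

lemma dilog_deriv_holomorphic: "dilog_deriv holomorphic_on dilog_domain"
proof -
  have "(\<lambda>z. - ln (1 - z) / z) holomorphic_on dilog_domain - {0}"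
    by (intro holomorphic_intros) (auto simp: dilog_domain_iff slit_plane_iff)
  then have "dilog_deriv holomorphic_on dilog_domain - {0}"
    by (rule holomorphic_transform) (auto simp: dilog_deriv_def)
  moreover have "isCont dilog_deriv 0"
  proof -
    let ?c = "\<lambda>n. 1 / of_nat (Suc n) :: complex"
    have sm: "(\<lambda>n. ?c n * w ^ n) sums dilog_deriv w" if "norm w < 1" for w
      using dilog_deriv_sums[OF that] by simp
    have "((\<lambda>w. \<Sum>n. ?c n * w ^ n) has_field_derivative (\<Sum>n. diffs ?c n * 0 ^ n)) (at 0)"
      by (rule termdiffs_strong'[of 1]) (use sm in \<open>auto simp: sums_iff\<close>)
    then have "(dilog_deriv has_field_derivative (\<Sum>n. diffs ?c n * 0 ^ n)) (at 0)"
      by (rule has_field_derivative_transform_within_open[of _ _ _ "ball 0 1"])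
         (use sm in \<open>auto simp: sums_iff\<close>)
    then show ?thesis by (rule DERIV_isCont)
  qed
  ultimately show ?thesis
    using no_isolated_singularity'[of "{0}" dilog_deriv dilog_domain] open_dilog_domain
    by (auto simp: isCont_def intro: tendsto_within_subset)
qed

text \<open>
  The slit domain is starlike, so the candidate derivative has a primitive there. It agrees
  with the series inside the disc by differentiation, and on the circle (except at 1) because
  both are continuous along radii.
\<close>

lemma Li2_eq_primitive:
  obtains g where "\<And>z. z \<in> dilog_domain \<Longrightarrow> (g has_field_derivative dilog_deriv z) (at z)"
    and "\<And>z. norm z \<le> 1 \<Longrightarrow> z \<noteq> 1 \<Longrightarrow> g z = Li2_series z"
proof -
  obtain h where h: "\<And>z. z \<in> dilog_domain \<Longrightarrow> (h has_field_derivative dilog_deriv z) (at z)"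
    using holomorphic_starlike_primitive[of dilog_domain dilog_deriv "{}"]
      dilog_deriv_holomorphic open_dilog_domain starlike_dilog_domain
    by (metis Diff_empty finite.emptyI holomorphic_on_imp_continuous_on holomorphic_on_imp_differentiable_at)
  define g where "g = (\<lambda>z. h z - h 0)"
  have g: "(g has_field_derivative dilog_deriv z) (at z)" if "z \<in> dilog_domain" for z
    unfolding g_def using h[OF that] by (auto intro!: derivative_eq_intros)
  have inner: "g z = Li2_series z" if "z \<in> ball 0 1" for z
  proof -
    have "((\<lambda>z. g z - Li2_series z) has_field_derivative 0) (at z within ball 0 1)"
      if z: "z \<in> ball 0 1" for z
    proof -
      have "z \<in> dilog_domain"
        using z complex_Re_le_cmod[of z] by (intro Re_less_1_in_dilog_domain) auto
      from DERIV_diff[OF g[OF this] Li2_series_has_derivative[of z]] z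
      show ?thesis by (auto intro: has_field_derivative_at_within)
    qed
    from has_field_derivative_zero_constant[OF convex_ball this]
    obtain c where c: "\<And>z. z \<in> ball 0 1 \<Longrightarrow> g z - Li2_series z = c" by blast
    have "Li2_series 0 = 0" by (simp add: Li2_series_def)
    then have "c = 0" using c[of 0] by (simp add: g_def)
    then show ?thesis using c[OF that] by simp
  qed
  have "g z = Li2_series z" if z: "norm z \<le> 1" "z \<noteq> 1" for z
  proof -
    have "isCont g z"
      by (rule DERIV_isCont[OF g[OF closed_disc_minus_1_dilog_domain[OF z]]])
    moreover have r: "((\<lambda>r. of_real r * z) \<longlongrightarrow> of_real 1 * z) (at_left 1)"
      by (intro tendsto_intros)
    ultimately have g_lim: "((\<lambda>r. g (of_real r * z)) \<longlongrightarrow> g z) (at_left 1)"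
      using isCont_tendsto_compose[of z g "\<lambda>r. of_real r * z" "at_left 1"] by simp
    have ev: "eventually (\<lambda>r::real. 0 < r \<and> r < 1) (at_left 1)"
      using eventually_at_left_real[of 0 1] by (simp add: greaterThanLessThan_def)
    have rz: "norm (of_real r * z) < 1" if "0 < r \<and> r < 1" for r :: real
    proof -
      have "norm (of_real r * z) = r * norm z" using that by (simp add: norm_mult)
      also have "\<dots> \<le> r * 1" using that z by (intro mult_left_mono) auto
      finally show ?thesis using that by simp
    qed
    have "((\<lambda>r. Li2_series (of_real r * z)) \<longlongrightarrow> Li2_series z) (at_left 1)"
      by (rule continuous_on_tendsto_compose[OF continuous_on_Li2_series])
         (use r z rz in \<open>auto intro!: eventually_mono[OF ev] intro: less_imp_le\<close>)
    moreover have "eventually (\<lambda>r. Li2_series (of_real r * z) = g (of_real r * z)) (at_left 1)"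
      using ev by eventually_elim (use rz inner in simp)
    ultimately have "((\<lambda>r. g (of_real r * z)) \<longlongrightarrow> Li2_series z) (at_left 1)"
      by (rule Lim_transform_eventually)
    with g_lim show ?thesis by (intro tendsto_unique[of "at_left (1::real)"]) auto
  qed
  then show ?thesis using that g by blast
qed

lemma Li2_eq_series: "norm z \<le> 1 \<Longrightarrow> Li2 z = Li2_series z"
  by (simp add: Li2_def)

lemma Li2_0 [simp]: "Li2 0 = 0"
  by (simp add: Li2_eq_series Li2_series_def)

lemma continuous_on_Li2_disc: "continuous_on (cball 0 1) Li2"
  by (rule continuous_on_eq[OF continuous_on_Li2_series]) (simp add: Li2_eq_series)

lemma Li2_1: "Li2 1 = of_real (pi ^ 2 / 6)"
proof -
  have "(\<lambda>n. of_real (1 / (real n + 1) ^ 2) :: complex) sums of_real (pi ^ 2 / 6)"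
    using inverse_squares_sums by (intro sums_of_real) (simp add: add_ac)
  moreover have "(\<lambda>n. of_real (1 / (real n + 1) ^ 2) :: complex) sums Li2_series 1"
    using Li2_series_sums[of 1] by (simp add: add_ac)
  ultimately have "of_real (pi ^ 2 / 6) = Li2_series 1" by (rule sums_unique2)
  then show ?thesis by (simp add: Li2_eq_series)
qed

lemma Li2_has_derivative:
  assumes "z \<in> dilog_domain"
  shows "(Li2 has_field_derivative dilog_deriv z) (at z)"
proof -
  obtain g where g: "\<And>z. z \<in> dilog_domain \<Longrightarrow> (g has_field_derivative dilog_deriv z) (at z)"
    "\<And>z. norm z \<le> 1 \<Longrightarrow> z \<noteq> 1 \<Longrightarrow> g z = Li2_series z" using Li2_eq_primitive by metis
  have *: "continuation (ball 0 1) dilog_domain Li2_series w = g w" if "w \<in> dilog_domain" for w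
  proof (rule continuation_eq)
    show "g z = Li2_series z" if "z \<in> ball 0 1" for z using g(2)[of z] that by (cases "z = 1") auto
    show "g holomorphic_on dilog_domain"
      using g(1) open_dilog_domain by (auto simp: holomorphic_on_open)
    show "connected dilog_domain" by (rule starlike_imp_connected[OF starlike_dilog_domain])
  qed (use that open_dilog_domain in \<open>auto intro!: closed_disc_minus_1_dilog_domain\<close>)
  have Li2_g: "g w = Li2 w" if "w \<in> dilog_domain" for w
  proof (cases "norm w \<le> 1")
    case True
    have "w \<noteq> 1" using that by (auto simp: dilog_domain_def)
    with True show ?thesis using g(2)[of w] by (simp add: Li2_def)
  next
    case False
    then show ?thesis using *[OF that] by (simp only: Li2_def dilog_domain_def if_False)
  qed
  show ?thesis
    by (rule has_field_derivative_transform_within_open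
        [OF g(1)[OF assms] open_dilog_domain assms Li2_g])
qed

text \<open>
  The derivative in terms of the logarithmic derivative \<open>d\<close> of the inner function. In this form
  the factor \<open>1 / g z\<close> of the derivative of \<open>Li\<^sub>2\<close> cancels, also at zeros of \<open>g\<close>, where
  \<open>ln (1 - g z)\<close> vanishes.
\<close>

lemma Li2_chain:
  assumes "(g has_field_derivative g z * d) (at z)" "1 - g z \<in> slit_plane"
  shows "((\<lambda>z. Li2 (g z)) has_field_derivative - ln (1 - g z) * d) (at z)"
proof -
  have "g z \<in> dilog_domain" using assms(2) by (simp add: dilog_domain_iff)
  note DERIV_chain2[OF Li2_has_derivative[OF this] assms(1)]
  also have "dilog_deriv (g z) * (g z * d) = - ln (1 - g z) * d"
    by (simp add: dilog_deriv_def)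
  finally show ?thesis .
qed

lemma continuous_on_Li2: "continuous_on dilog_domain Li2"
  by (intro continuous_at_imp_continuous_on ballI DERIV_isCont[OF Li2_has_derivative])

section \<open>Dilogarithm identities\<close>

lemma Re_pos_imp_nonzero: "Re z > 0 \<Longrightarrow> z \<noteq> 0"
  by auto

text \<open>
  The arguments of \<open>a\<close> and \<open>b\<close> are below \<open>\<pi> / 2\<close> in absolute value, so that of the quotient
  stays below \<open>\<pi>\<close>. This is why no term of the dilogarithm identity meets a branch cut.
\<close>

lemma Re_divide_pos_in_slit_plane:
  assumes "Re a > 0" "Re b > 0"
  shows "a / b \<in> slit_plane"
proof -
  have False if "a / b \<in> \<real>\<^sub>\<le>\<^sub>0"
  proof -
    from that obtain t where t: "a / b = of_real t" "t \<le> 0"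
      by (auto simp: nonpos_Reals_def)
    have "b \<noteq> 0" using assms(2) by auto
    then have "a = of_real t * b" using t(1) by (simp add: field_simps)
    then have "Re a = t * Re b" by simp
    also have "\<dots> \<le> 0" using t(2) assms(2) by (intro mult_nonpos_nonneg) auto
    finally show False using assms(1) by simp
  qed
  then show ?thesis by (auto simp: slit_plane_iff)
qed

lemma Ln_times_Re_pos:
  assumes "Re a > 0" "Re b > 0"
  shows "ln (a * b) = ln a + ln b"
  using Re_Ln_pos_lt_imp[OF assms(1)] Re_Ln_pos_lt_imp[OF assms(2)] assms
  by (intro Ln_times_simple) auto

lemma Ln_divide_Re_pos:
  assumes "Re a > 0" "Re b > 0"
  shows "ln (a / b) = ln a - ln b"
proof -
  have "Re (inverse b) > 0" using assms(2)
    by (auto simp: Re_divide power2_eq_square intro!: divide_pos_pos add_pos_nonneg)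
  moreover have "ln (inverse b) = - ln b"
    using assms(2) by (intro Ln_inverse) (auto simp: complex_nonpos_Reals_iff)
  ultimately show ?thesis using Ln_times_Re_pos[of a "inverse b"] assms
    by (simp add: divide_inverse)
qed

lemma Re_one_minus_scaled_pos:
  assumes "norm u \<le> 1" "u \<noteq> 1" "0 \<le> r" "r \<le> 1"
  shows "Re (1 - of_real r * u) > 0"
proof -
  have "Re u < 1"
  proof (rule ccontr)
    assume "\<not> Re u < 1"
    then have "Re u = 1" using complex_Re_le_cmod[of u] assms(1) by simp
    moreover have "(Re u)\<^sup>2 + (Im u)\<^sup>2 \<le> 1"
      using assms(1) by (simp add: cmod_def)
    ultimately show False using assms(2) by (simp add: complex_eq_iff)
  qed
  have "r * Re u < 1"
  proof (cases "r = 0")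
    case False
    then have "r * Re u < r * 1" using \<open>Re u < 1\<close> assms(3) by (intro mult_strict_left_mono) auto
    then show ?thesis using assms(4) by simp
  qed simp
  then show ?thesis by simp
qed

lemma Re_one_minus_pos: "norm u \<le> 1 \<Longrightarrow> u \<noteq> 1 \<Longrightarrow> Re (1 - u) > 0"
  using Re_one_minus_scaled_pos[of u 1] by simp

lemma one_minus_moebius:
  fixes a b w :: complex
  assumes "1 - w * b \<noteq> 0"
  shows "1 - w * a / (w * b - 1) = (1 - w * (b - a)) / (1 - w * b)"
proof -
  have "w * b - 1 \<noteq> 0" using assms by auto
  then show ?thesis using assms by (simp add: divide_simps) (simp add: algebra_simps)
qed

text \<open>
  Most arguments in the dilogarithm identity, scaled by \<open>w\<close>, have the form \<open>w a / (w b - 1)\<close>,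
  and one minus such a number is again a quotient of the kind treated above.
\<close>

lemma Li2_moebius_has_derivative:
  assumes "Re (1 - w * (b - a)) > 0" "Re (1 - w * b) > 0" "w \<noteq> 0"
  shows "((\<lambda>w. Li2 (w * a / (w * b - 1))) has_field_derivative
     (ln (1 - w * b) - ln (1 - w * (b - a))) * (1 / w + b / (1 - w * b))) (at w)"
proof -
  note ne = Re_pos_imp_nonzero[OF assms(2)]
  then have ne': "w * b - 1 \<noteq> 0" by auto
  note eq = one_minus_moebius[OF ne]
  have "((\<lambda>w. w * a / (w * b - 1)) has_field_derivative
      w * a / (w * b - 1) * (1 / w + b / (1 - w * b))) (at w)"
    using ne ne' assms(3)
    by (auto intro!: derivative_eq_intros simp: divide_simps) (simp add: algebra_simps)
  from Li2_chain[OF this] show ?thesis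
    by (simp add: eq Ln_divide_Re_pos assms Re_divide_pos_in_slit_plane del: minus_complex.simps)
qed

lemma continuous_on_Li2_moebius:
  assumes "\<And>r. r \<in> S \<Longrightarrow> Re (1 - of_real r * (b - a)) > 0"
    and "\<And>r. r \<in> S \<Longrightarrow> Re (1 - of_real r * b) > 0"
  shows "continuous_on S (\<lambda>r. Li2 (of_real r * a / (of_real r * b - 1)))"
proof (rule continuous_on_compose2[OF continuous_on_Li2])
  have ne: "1 - of_real r * b \<noteq> 0" if "r \<in> S" for r
    by (rule Re_pos_imp_nonzero[OF assms(2)[OF that]])
  then show "continuous_on S (\<lambda>r. of_real r * a / (of_real r * b - 1))"
    by (intro continuous_intros) auto
  show "(\<lambda>r. of_real r * a / (of_real r * b - 1)) ` S \<subseteq> dilog_domain"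
    using one_minus_moebius[OF ne] Re_divide_pos_in_slit_plane[OF assms]
    by (auto simp: dilog_domain_iff)
qed

lemma eq_of_vector_derivative_0:
  fixes G :: "real \<Rightarrow> 'a :: banach"
  assumes "a \<le> b" "continuous_on {a..b} G"
    and "\<And>t. a < t \<Longrightarrow> t < b \<Longrightarrow> (G has_vector_derivative 0) (at t)"
  shows "G b = G a"
proof -
  have "((\<lambda>t. 0) has_integral G b - G a) {a..b}"
    using assms by (intro fundamental_theorem_of_calculus_interior) auto
  then show ?thesis by (simp add: has_integral_0_eq)
qed

text \<open>
  Replace \<open>u, v, s\<close> by \<open>w u, w v, w s\<close>. At \<open>w = 0\<close> everything vanishes. The logarithmic
  derivatives in \<open>w\<close> of all arguments are combinations of \<open>a = 1 / w\<close>, \<open>b = u / (1 - w u)\<close> and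
  \<open>c = v / (1 - w v)\<close>, so the derivative of the difference \<open>G\<close> of both sides is bilinear in
  these numbers and in the four logarithms of \<open>1 - w u\<close>, \<open>1 - w v\<close>, \<open>1 + w s\<close>, \<open>1 - w s\<close>, and
  it is identically zero.
\<close>

lemma dilog_square_root_identity:
  assumes u: "norm u \<le> 1" "u \<noteq> 1" and v: "norm v \<le> 1" "v \<noteq> 1"
    and s: "s\<^sup>2 = u * v" "u * v \<noteq> 1"
  shows "Li2 (v * (1 - u) / (v - 1)) - ln (1 - u) * ln (1 - v) =
    Li2 u + 2 * Li2 (u / (u - 1)) - Li2 ((u - v) / (1 - v)) + Li2 (u * v) / 2
    - (Li2 ((u + s) / (u - 1)) + Li2 ((u - s) / (u - 1))
       - Li2 ((v + s) / (v - 1)) - Li2 ((v - s) / (v - 1)))"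
proof -
  define G where "G = (\<lambda>w. Li2 (w * v * (1 - w * u) / (w * v - 1)) - ln (1 - w * u) * ln (1 - w * v)
     - Li2 (w * u) - 2 * Li2 (w * u / (w * u - 1)) + Li2 (w * (v - u) / (w * v - 1))
     - Li2 (w\<^sup>2 * (u * v)) / 2
     + (Li2 (w * (u + s) / (w * u - 1)) + Li2 (w * (u - s) / (w * u - 1))
        - Li2 (w * (v + s) / (w * v - 1)) - Li2 (w * (v - s) / (w * v - 1))))"
  have uv: "norm (u * v) \<le> 1"
    using u(1) v(1) by (simp add: norm_mult mult_le_one)
  then have "norm s ^ 2 \<le> 1" using s(1) by (metis norm_power)
  then have ns: "norm s \<le> 1" by (simp add: power2_le_imp_le[of _ 1])
  have s1: "s \<noteq> 1" "-s \<noteq> 1"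
    using s by (auto simp: minus_equation_iff[of s])
  have pos: "Re (1 - of_real r * u) > 0" "Re (1 - of_real r * v) > 0"
    "Re (1 - of_real r * s) > 0" "Re (1 - of_real r * (-s)) > 0"
    "Re (1 - (of_real r)\<^sup>2 * (u * v)) > 0"
    if "0 \<le> r" "r \<le> 1" for r
    using Re_one_minus_scaled_pos[OF u that] Re_one_minus_scaled_pos[OF v that]
      Re_one_minus_scaled_pos[OF ns s1(1) that]
      Re_one_minus_scaled_pos[OF _ s1(2) that] ns
      Re_one_minus_scaled_pos[OF uv s(2), of "r\<^sup>2"] that
    by (simp_all add: power_le_one flip: of_real_power del: minus_complex.simps times_complex.simps)
  have first: "1 - w * v * (1 - w * u) / (w * v - 1) = (1 - w\<^sup>2 * (u * v)) / (1 - w * v)"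
    if "1 - w * v \<noteq> 0" for w
  proof -
    have "w * v - 1 \<noteq> 0" using that by auto
    then show ?thesis using that
      by (simp add: divide_simps) (simp add: algebra_simps power2_eq_square)
  qed
  have "G (of_real 1) = G (of_real 0)"
  proof (rule eq_of_vector_derivative_0)
    have sl: "1 - of_real r * u \<in> slit_plane" "1 - of_real r * v \<in> slit_plane"
      "1 - (of_real r)\<^sup>2 * (u * v) \<in> slit_plane"
      "1 - of_real r * v * (1 - of_real r * u) / (of_real r * v - 1) \<in> slit_plane"
      "1 - of_real r * v \<noteq> 0"
      if r: "r \<in> {0..1}" for r
    proof -
      show "1 - of_real r * v \<noteq> 0" by (rule Re_pos_imp_nonzero) (use pos(2) r in auto)
      then show "1 - of_real r * v * (1 - of_real r * u) / (of_real r * v - 1) \<in> slit_plane"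
        using first Re_divide_pos_in_slit_plane[OF pos(5,2)[of r]] r by auto
    qed (use r pos(1,2,5)[of r] in \<open>auto simp: slit_plane_iff complex_nonpos_Reals_iff\<close>)
    have P: "Re (1 - of_real r * (u - (u + s))) > 0" "Re (1 - of_real r * (u - (u - s))) > 0"
      "Re (1 - of_real r * (v - (v + s))) > 0" "Re (1 - of_real r * (v - (v - s))) > 0"
      "Re (1 - of_real r * (u - u)) > 0" "Re (1 - of_real r * (v - (v - u))) > 0"
      "Re (1 - of_real r * u) > 0" "Re (1 - of_real r * v) > 0"
      if r: "r \<in> {0..1}" for r
      using pos[of r] r by simp_all
    show "continuous_on {0..1} (\<lambda>r. G (of_real r))"
      unfolding G_def
      by (intro continuous_intros continuous_on_Li2_moebius P continuous_on_compose2[OF continuous_on_Li2])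
         (use sl in \<open>auto simp: dilog_domain_iff simp flip: slit_plane_iff\<close>)
  next
    fix r :: real
    assume r: "0 < r" "r < 1"
    define w where "w = complex_of_real r"
    have w: "w \<noteq> 0" using r by (simp add: w_def)
    note p = pos[of r, folded w_def]
    have ne: "1 - w * u \<noteq> 0" "1 - w * v \<noteq> 0" "1 - w\<^sup>2 * (u * v) \<noteq> 0"
      using Re_pos_imp_nonzero[OF p(1)] Re_pos_imp_nonzero[OF p(2)] Re_pos_imp_nonzero[OF p(5)] r
      by simp_all
    define U V P M where "U = ln (1 - w * u)" and "V = ln (1 - w * v)"
      and "P = ln (1 + w * s)" and "M = ln (1 - w * s)"
    define a b c where "a = 1 / w" and "b = u / (1 - w * u)" and "c = v / (1 - w * v)"
    have "1 - w\<^sup>2 * (u * v) = (1 + w * s) * (1 - w * s)"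
      by (simp add: algebra_simps power2_eq_square flip: s(1))
    then have PM: "ln (1 - w\<^sup>2 * (u * v)) = P + M"
      using p(3,4) r by (simp add: P_def M_def Ln_times_Re_pos del: minus_complex.simps)
    have dU: "((\<lambda>w. ln (1 - w * u)) has_field_derivative - b) (at w)"
      and dV: "((\<lambda>w. ln (1 - w * v)) has_field_derivative - c) (at w)"
      using p(1,2) r ne unfolding b_def c_def
      by (auto intro!: derivative_eq_intros simp: complex_nonpos_Reals_iff divide_simps
            simp del: minus_complex.simps)
    have d1: "((\<lambda>w. Li2 (w * v * (1 - w * u) / (w * v - 1)))
        has_field_derivative - (P + M - V) * (a - b + c)) (at w)"
    proof -
      have "w * v - 1 \<noteq> 0" using ne(2) by auto
      then have "((\<lambda>w. w * v * (1 - w * u) / (w * v - 1)) has_field_derivative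
          w * v * (1 - w * u) / (w * v - 1) * (a - b + c)) (at w)"
        unfolding a_def b_def c_def using w ne
        by (auto intro!: derivative_eq_intros simp: divide_simps) (simp add: algebra_simps power2_eq_square)
      from Li2_chain[OF this] have "((\<lambda>w. Li2 (w * v * (1 - w * u) / (w * v - 1)))
          has_field_derivative
            - ln ((1 - w\<^sup>2 * (u * v)) / (1 - w * v)) * (a - b + c)) (at w)"
        unfolding first[OF ne(2)] using Re_divide_pos_in_slit_plane[OF p(5,2)] r by simp
      also have "ln ((1 - w\<^sup>2 * (u * v)) / (1 - w * v)) = P + M - V"
        using Ln_divide_Re_pos[OF p(5,2)] r by (simp add: PM V_def)
      finally show ?thesis .
    qed
    have d2: "((\<lambda>w. Li2 (w * u)) has_field_derivative - U * a) (at w)"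
      unfolding U_def a_def using w p(1) r
      by (intro Li2_chain) (auto intro!: derivative_eq_intros simp: slit_plane_iff complex_nonpos_Reals_iff)
    have d3: "((\<lambda>w. Li2 (w\<^sup>2 * (u * v))) has_field_derivative - (P + M) * (2 * a)) (at w)"
      unfolding PM[symmetric] a_def using w p(5) r
      by (intro Li2_chain) (auto intro!: derivative_eq_intros
          simp: slit_plane_iff complex_nonpos_Reals_iff power2_eq_square)
    have d4: "((\<lambda>w. Li2 (w * u / (w * u - 1))) has_field_derivative U * (a + b)) (at w)"
      using Li2_moebius_has_derivative[of w u u] p r w by (simp add: U_def a_def b_def)
    have d5: "((\<lambda>w. Li2 (w * (v - u) / (w * v - 1))) has_field_derivative (V - U) * (a + c)) (at w)"
      using Li2_moebius_has_derivative[of w v "v - u"] p r w by (simp add: U_def V_def a_def c_def)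
    have d6: "((\<lambda>w. Li2 (w * (u + s) / (w * u - 1))) has_field_derivative (U - P) * (a + b)) (at w)"
      using Li2_moebius_has_derivative[of w u "u + s"] p r w by (simp add: U_def P_def a_def b_def)
    have d7: "((\<lambda>w. Li2 (w * (u - s) / (w * u - 1))) has_field_derivative (U - M) * (a + b)) (at w)"
      using Li2_moebius_has_derivative[of w u "u - s"] p r w by (simp add: U_def M_def a_def b_def)
    have d8: "((\<lambda>w. Li2 (w * (v + s) / (w * v - 1))) has_field_derivative (V - P) * (a + c)) (at w)"
      using Li2_moebius_has_derivative[of w v "v + s"] p r w by (simp add: V_def P_def a_def c_def)
    have d9: "((\<lambda>w. Li2 (w * (v - s) / (w * v - 1))) has_field_derivative (V - M) * (a + c)) (at w)"
      using Li2_moebius_has_derivative[of w v "v - s"] p r w by (simp add: V_def M_def a_def c_def)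
    (* the terms of G in order, with U, V, P, M for the four logarithms *)
    have "(G has_field_derivative
        - (P + M - V) * (a - b + c) - (- b * V + - c * U)
        - (- U * a) - 2 * (U * (a + b)) + (V - U) * (a + c) - - (P + M) * (2 * a) / 2
        + ((U - P) * (a + b) + (U - M) * (a + b) - (V - P) * (a + c) - (V - M) * (a + c))) (at w)"
      unfolding G_def U_def V_def
      by (intro DERIV_add DERIV_diff DERIV_mult DERIV_cmult DERIV_cdivide
          dU dV d1[unfolded U_def V_def] d2[unfolded U_def] d3 d4[unfolded U_def]
          d5[unfolded U_def V_def] d6[unfolded U_def] d7[unfolded U_def]
          d8[unfolded V_def] d9[unfolded V_def])
    also have "- (P + M - V) * (a - b + c) - (- b * V + - c * U)
        - (- U * a) - 2 * (U * (a + b)) + (V - U) * (a + c) - - (P + M) * (2 * a) / 2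
        + ((U - P) * (a + b) + (U - M) * (a + b) - (V - P) * (a + c) - (V - M) * (a + c)) = 0"
      by (simp add: field_simps)
    finally show "((\<lambda>r. G (of_real r)) has_vector_derivative 0) (at r)"
      unfolding w_def by (rule has_vector_derivative_real_field)
  qed simp
  moreover have "(v - u) / (v - 1) = (u - v) / (1 - v)"
    by (metis minus_diff_eq minus_divide_divide)
  ultimately show ?thesis
    by (simp add: G_def algebra_simps)
qed

text \<open>
  Both sides have the same derivative; the constant is found as \<open>z\<close> tends to 0 along the
  positive reals, where \<open>ln z * ln (1 - z)\<close> tends to 0.
\<close>

lemma Li2_reflection:
  assumes "0 < Re z" "Re z < 1"
  shows "Li2 z + Li2 (1 - z) = of_real (pi\<^sup>2 / 6) - ln z * ln (1 - z)"
proof -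
  define h where "h = (\<lambda>z. Li2 z + Li2 (1 - z) + ln z * ln (1 - z))"
  define S where "S = {z. 0 < Re z \<and> Re z < 1}"
  have "S = {z. 0 < Re z} \<inter> {z. Re z < 1}" by (auto simp: S_def)
  then have "convex S"
    by (simp only: convex_Int convex_halfspace_Re_gt convex_halfspace_Re_lt)
  moreover have "(h has_field_derivative 0) (at z within S)" if "z \<in> S" for z
  proof -
    from that have z: "0 < Re z" "Re z < 1" by (auto simp: S_def)
    then have ne: "z \<noteq> 0" "1 - z \<noteq> 0" by auto
    have "((\<lambda>z. Li2 (1 - z)) has_field_derivative - ln (1 - (1 - z)) * (- 1 / (1 - z))) (at z)"
      using ne z by (intro Li2_chain)
        (auto intro!: derivative_eq_intros simp: slit_plane_iff complex_nonpos_Reals_iff)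
    moreover have "((\<lambda>z. Li2 z) has_field_derivative - ln (1 - z) * (1 / z)) (at z)"
      using ne z by (intro Li2_chain)
        (auto intro!: derivative_eq_intros simp: slit_plane_iff complex_nonpos_Reals_iff)
    ultimately have "(h has_field_derivative 0) (at z)"
      unfolding h_def using ne z
      by (auto intro!: derivative_eq_intros simp: complex_nonpos_Reals_iff divide_inverse)
    then show ?thesis by (rule has_field_derivative_at_within)
  qed
  ultimately obtain c where c: "\<And>z. z \<in> S \<Longrightarrow> h z = c"
    using has_field_derivative_zero_constant[of S h] by blast
  have "((\<lambda>t. h (of_real t)) \<longlongrightarrow> Li2 0 + Li2 1 + of_real 0) (at_right 0)"
  proof -
    have ev: "eventually (\<lambda>t::real. 0 < t \<and> t < 1) (at_right 0)"
      using eventually_at_right_real[of 0 1] by (simp add: greaterThanLessThan_def)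
    have "((\<lambda>t. complex_of_real (ln t * ln (1 - t))) \<longlongrightarrow> of_real 0) (at_right 0)"
      by (intro tendsto_of_real) real_asymp
    moreover have "eventually (\<lambda>t. complex_of_real (ln t * ln (1 - t)) =
        ln (of_real t) * ln (1 - of_real t)) (at_right 0)"
      using ev
    proof eventually_elim
      case (elim t)
      then show ?case using Ln_of_real[of t] Ln_of_real[of "1 - t"] by simp
    qed
    ultimately have ln_lim: "((\<lambda>t. ln (complex_of_real t) * ln (1 - of_real t)) \<longlongrightarrow> of_real 0) (at_right 0)"
      by (rule Lim_transform_eventually)
    have t0: "((\<lambda>t. complex_of_real t) \<longlongrightarrow> of_real 0) (at_right 0)"
      by (intro tendsto_intros)
    have "((\<lambda>t. Li2 (of_real t)) \<longlongrightarrow> Li2 (of_real 0)) (at_right 0)"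
      by (rule continuous_on_tendsto_compose[OF continuous_on_Li2_disc t0])
         (use ev in \<open>auto elim!: eventually_mono\<close>)
    moreover have t1: "((\<lambda>t. complex_of_real (1 - t)) \<longlongrightarrow> of_real (1 - 0)) (at_right 0)"
      by (intro tendsto_intros)
    have "((\<lambda>t. Li2 (of_real (1 - t))) \<longlongrightarrow> Li2 (of_real (1 - 0))) (at_right 0)"
      by (rule continuous_on_tendsto_compose[OF continuous_on_Li2_disc t1])
         (use ev in \<open>auto elim!: eventually_mono simp flip: of_real_diff simp del: of_real_diff\<close>)
    ultimately show ?thesis
      unfolding h_def using ln_lim by (intro tendsto_add) auto
  qed
  moreover have "eventually (\<lambda>t. h (of_real t) = c) (at_right 0)"
    using eventually_at_right_real[of 0 1] by (auto elim!: eventually_mono intro: c simp: S_def)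
  ultimately have "((\<lambda>t::real. c) \<longlongrightarrow> Li2 0 + Li2 1 + of_real 0) (at_right 0)"
    by (rule Lim_transform_eventually)
  then have "c = Li2 0 + Li2 1 + of_real 0"
    by (rule tendsto_unique[OF trivial_limit_at_right_real tendsto_const])
  then have "c = of_real (pi\<^sup>2 / 6)" by (simp add: Li2_1)
  moreover have "h z = c" using assms by (intro c) (auto simp: S_def)
  ultimately show ?thesis by (simp add: h_def algebra_simps)
qed

text \<open>
  Write \<open>u = exp (\<i> \<theta>)\<close> with \<open>0 < \<theta> < 2 \<pi>\<close>, so that \<open>ln (- u) = \<i> (\<theta> - \<pi>)\<close>. The derivative in
  \<open>\<theta>\<close> of the difference of both sides is zero, and its value at the endpoint \<open>\<theta> = 0\<close>, with
  \<open>ln (- u)\<close> replaced by its limit, is given by \<open>Li\<^sub>2(1) = \<pi>\<^sup>2 / 6\<close>.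
\<close>

lemma Li2_inversion_on_circle:
  assumes "norm u = 1" "u \<noteq> 1"
  shows "Li2 u + Li2 (inverse u) = - of_real (pi\<^sup>2 / 6) - (ln (- u))\<^sup>2 / 2"
proof -
  define G where "G = (\<lambda>w. Li2 (exp (\<i> * w)) + Li2 (exp (- (\<i> * w))) - (w - of_real pi)\<^sup>2 / 2)"
  define \<theta> where "\<theta> = Arg2pi u"
  have \<theta>: "0 \<le> \<theta>" "\<theta> < 2 * pi" "u = exp (\<i> * of_real \<theta>)"
    using Arg2pi[of u] assms(1) by (auto simp: \<theta>_def is_Arg_def)
  have "\<theta> \<noteq> 0" using \<theta>(3) assms(2) by auto
  with \<theta> have \<theta>_pos: "0 < \<theta>" by simp
  have ln_minus: "ln (- exp (\<i> * of_real t)) = \<i> * (of_real t - of_real pi)"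
    if "0 < t" "t < 2 * pi" for t
  proof (rule Ln_unique)
    show "exp (\<i> * (of_real t - of_real pi)) = - exp (\<i> * of_real t)"
      by (simp add: algebra_simps exp_diff mult.commute[of "of_real pi"])
  qed (use that in auto)
  have ne1: "exp (\<i> * of_real t) \<noteq> 1" if "0 < t" "t < 2 * pi" for t
  proof
    assume "exp (\<i> * of_real t) = 1"
    then obtain n :: int where n: "t = of_int (2 * n) * pi" by (auto simp: exp_eq_1)
    then have "0 < of_int (2 * n) * pi" "of_int (2 * n) * pi < 2 * pi" using that by auto
    then have "0 < n" "n < 1" by (auto simp: zero_less_mult_iff)
    then show False by simp
  qed
  have "G (of_real \<theta>) = G (of_real 0)"
  proof (rule eq_of_vector_derivative_0)
    show "continuous_on {0..\<theta>} (\<lambda>t. G (of_real t))"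
      unfolding G_def
      by (intro continuous_intros continuous_on_compose2[OF continuous_on_Li2_disc]) auto
  next
    fix t :: real
    assume t: "0 < t" "t < \<theta>"
    define w where "w = complex_of_real t"
    define y where "y = exp (\<i> * w)"
    have y: "norm y = 1" "y \<noteq> 1" "y \<noteq> 0" "inverse y \<noteq> 1" "exp (- (\<i> * w)) = inverse y"
      using ne1[of t] t \<theta> by (auto simp: y_def w_def exp_minus)
    have Re_pos: "Re (1 - y) > 0" "Re (1 - inverse y) > 0"
      using y by (auto intro!: Re_one_minus_pos simp: norm_inverse simp del: minus_complex.simps)
    have "ln (1 - y) - ln (1 - inverse y) = ln ((1 - y) / (1 - inverse y))"
      by (rule Ln_divide_Re_pos[OF Re_pos, symmetric])
    also have "(1 - y) / (1 - inverse y) = - y"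
      using y by (simp add: divide_simps) (simp add: algebra_simps)
    also have "ln (- y) = \<i> * (w - of_real pi)"
      using t \<theta> by (simp add: y_def w_def ln_minus)
    finally have ln_eq: "ln (1 - y) = ln (1 - inverse y) + \<i> * (w - of_real pi)"
      by (simp add: algebra_simps)
    have "((\<lambda>w. Li2 (exp (\<i> * w))) has_field_derivative - ln (1 - exp (\<i> * w)) * \<i>) (at w)"
      using Re_pos(1) by (intro Li2_chain)
        (auto intro!: derivative_eq_intros simp: slit_plane_iff complex_nonpos_Reals_iff y_def)
    moreover have "((\<lambda>w. Li2 (exp (- (\<i> * w)))) has_field_derivative
        - ln (1 - exp (- (\<i> * w))) * (- \<i>)) (at w)"
      using Re_pos(2) y(5) by (intro Li2_chain)
        (auto intro!: derivative_eq_intros simp: slit_plane_iff complex_nonpos_Reals_iff)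
    ultimately have "(G has_field_derivative 0) (at w)"
      unfolding G_def
      by (auto intro!: derivative_eq_intros simp: y(5) ln_eq simp flip: y_def) (simp add: algebra_simps)
    then show "((\<lambda>t. G (of_real t)) has_vector_derivative 0) (at t)"
      unfolding w_def by (rule has_vector_derivative_real_field)
  qed (use \<theta> in simp)
  moreover have "ln (- u) = \<i> * (of_real \<theta> - of_real pi)"
    using ln_minus[of \<theta>] \<theta> \<theta>_pos by simp
  moreover have "exp (- (\<i> * of_real \<theta>)) = inverse u" using \<theta> by (simp add: exp_minus)
  ultimately have "Li2 u + Li2 (inverse u) - (of_real \<theta> - of_real pi)\<^sup>2 / 2 =
      2 * of_real (pi\<^sup>2 / 6) - of_real pi ^ 2 / 2"
    and ln_u: "ln (- u) = \<i> * (of_real \<theta> - of_real pi)"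
    using \<theta>(3) by (simp_all add: G_def Li2_1)
  moreover have "(ln (- u))\<^sup>2 = - (of_real \<theta> - of_real pi)\<^sup>2"
    by (simp add: ln_u power_mult_distrib)
  ultimately show ?thesis by (simp add: field_simps)
qed

section \<open>Double series\<close>

lemma has_sum_product:
  fixes f :: "'a \<Rightarrow> 'c :: {real_normed_field, banach}" and g :: "'b \<Rightarrow> 'c"
  assumes f: "(\<lambda>m. norm (f m)) summable_on A" "(f has_sum F) A"
    and g: "(\<lambda>n. norm (g n)) summable_on B" "(g has_sum G) B"
  shows "((\<lambda>(m, n). f m * g n) has_sum F * G) (A \<times> B)"
    and "(\<lambda>(m, n). norm (f m) * norm (g n)) summable_on A \<times> B"
proof -
  show norm: "(\<lambda>(m, n). norm (f m) * norm (g n)) summable_on A \<times> B"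
  proof (rule summable_on_SigmaI)
    show "((\<lambda>n. case (m, n) of (m, n) \<Rightarrow> norm (f m) * norm (g n)) has_sum
        norm (f m) * (\<Sum>\<^sub>\<infinity>n\<in>B. norm (g n))) B" for m
      using has_sum_cmult_right[OF has_sum_infsum[OF g(1)]] by simp
    show "(\<lambda>m. norm (f m) * (\<Sum>\<^sub>\<infinity>n\<in>B. norm (g n))) summable_on A"
      using f(1) by (rule summable_on_cmult_left)
  qed auto
  have "(\<lambda>(m, n). f m * g n) summable_on A \<times> B"
    by (rule abs_summable_summable) (use norm in \<open>simp add: case_prod_unfold norm_mult\<close>)
  then show "((\<lambda>(m, n). f m * g n) has_sum F * G) (A \<times> B)"
  proof (rule has_sum_SigmaI[rotated 2])
    show "((\<lambda>n. case (m, n) of (m, n) \<Rightarrow> f m * g n) has_sum f m * G) B" for m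
      using has_sum_cmult_right[OF g(2)] by simp
    show "((\<lambda>m. f m * G) has_sum F * G) A"
      by (rule has_sum_cmult_left[OF f(2)])
  qed
qed

lemma continuous_on_infsum:
  fixes f :: "'i \<Rightarrow> 'a :: topological_space \<Rightarrow> 'b :: banach"
  assumes "\<And>k. k \<in> I \<Longrightarrow> continuous_on S (f k)"
    and "M summable_on I" "\<And>k s. k \<in> I \<Longrightarrow> s \<in> S \<Longrightarrow> norm (f k s) \<le> M k"
  shows "continuous_on S (\<lambda>s. \<Sum>\<^sub>\<infinity>k\<in>I. f k s)"
proof (rule uniform_limit_theorem)
  show "uniform_limit S (\<lambda>F s. \<Sum>k\<in>F. f k s) (\<lambda>s. \<Sum>\<^sub>\<infinity>k\<in>I. f k s) (finite_subsets_at_top I)"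
    by (rule Weierstrass_m_test_general[OF assms(3,2)])
  show "eventually (\<lambda>F. continuous_on S (\<lambda>s. \<Sum>k\<in>F. f k s)) (finite_subsets_at_top I)"
    by (intro eventually_finite_subsets_at_top_weakI continuous_on_sum assms(1)) blast
qed simp

lemma has_sum_diff:
  fixes f g :: "'i \<Rightarrow> 'b :: real_normed_vector"
  assumes "(f has_sum a) A" "(g has_sum b) A"
  shows "((\<lambda>x. f x - g x) has_sum a - b) A"
proof -
  have "((\<lambda>x. - g x) has_sum - b) A"
    using has_sum_uminus[where f = g and a = "- b" and A = A] assms(2) by simp
  from has_sum_add[OF assms(1) this] show ?thesis by (simp only: diff_conv_add_uminus)
qed

lemma holomorphic_on_infsum:
  fixes f :: "'i \<Rightarrow> complex \<Rightarrow> complex"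
  assumes "open S" "\<And>k. k \<in> I \<Longrightarrow> f k holomorphic_on S"
    and bound: "\<And>K. compact K \<Longrightarrow> K \<subseteq> S \<Longrightarrow>
      \<exists>M. M summable_on I \<and> (\<forall>k\<in>I. \<forall>z\<in>K. norm (f k z) \<le> M k)"
  shows "(\<lambda>z. \<Sum>\<^sub>\<infinity>k\<in>I. f k z) holomorphic_on S"
proof -
  have "(\<lambda>z. \<Sum>\<^sub>\<infinity>k\<in>I. f k z) field_differentiable at z" if z: "z \<in> S" for z
  proof -
    obtain r where r: "r > 0" "cball z r \<subseteq> S"
      using bspec[OF open_contains_cball[THEN iffD1, OF \<open>open S\<close>] z] by blast
    obtain M where M: "M summable_on I" "\<forall>k\<in>I. \<forall>w\<in>cball z r. norm (f k w) \<le> M k"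
      using bound[OF compact_cball r(2)] by blast
    have lim: "uniform_limit (cball z r) (\<lambda>F w. \<Sum>k\<in>F. f k w) (\<lambda>w. \<Sum>\<^sub>\<infinity>k\<in>I. f k w)
        (finite_subsets_at_top I)"
      by (rule Weierstrass_m_test_general[OF _ M(1)]) (use M(2) in blast)
    have ev: "eventually (\<lambda>F. continuous_on (cball z r) (\<lambda>w. \<Sum>k\<in>F. f k w) \<and>
        (\<lambda>w. \<Sum>k\<in>F. f k w) holomorphic_on ball z r) (finite_subsets_at_top I)"
    proof (rule eventually_finite_subsets_at_top_weakI)
      fix F assume "finite F" "F \<subseteq> I"
      then have "(\<lambda>w. \<Sum>k\<in>F. f k w) holomorphic_on S"
        by (intro holomorphic_on_sum assms(2)) blast
      then have "(\<lambda>w. \<Sum>k\<in>F. f k w) holomorphic_on cball z r"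
        using r(2) by (rule holomorphic_on_subset)
      then show "continuous_on (cball z r) (\<lambda>w. \<Sum>k\<in>F. f k w) \<and>
          (\<lambda>w. \<Sum>k\<in>F. f k w) holomorphic_on ball z r"
        by (intro conjI holomorphic_on_imp_continuous_on holomorphic_on_subset[OF _ ball_subset_cball])
    qed
    have "(\<lambda>w. \<Sum>\<^sub>\<infinity>k\<in>I. f k w) holomorphic_on ball z r"
      using holomorphic_uniform_limit[OF ev lim finite_subsets_at_top_neq_bot] .
    then show ?thesis
      by (rule holomorphic_on_imp_differentiable_at) (use r in auto)
  qed
  then show ?thesis
    unfolding holomorphic_on_def by (metis field_differentiable_at_within)
qed

text \<open>
  After scaling to \<open>a + b = 1\<close> the number \<open>a x + b\<close> lies on the segment from 1 to \<open>x\<close>, which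
  avoids 0 because \<open>x\<close> is not on the cut. By compactness the distance to 0 has a positive
  minimum.
\<close>

lemma slit_plane_linear_lower_bound:
  assumes "compact K" "K \<subseteq> slit_plane"
  shows "\<exists>c>0. \<forall>x\<in>K. \<forall>a\<ge>0. \<forall>b\<ge>0. c * (a + b) \<le> norm (of_real a * x + of_real b)"
proof (cases "K = {}")
  case False
  define f where "f = (\<lambda>(x, l). norm (complex_of_real l * x + of_real (1 - l)))"
  have "compact (K \<times> {0..1::real})" "K \<times> {0..1::real} \<noteq> {}" "continuous_on (K \<times> {0..1}) f"
    using assms False by (auto simp: f_def case_prod_unfold intro!: compact_Times continuous_intros)
  then obtain p where p: "p \<in> K \<times> {0..1}" "\<And>q. q \<in> K \<times> {0..1} \<Longrightarrow> f p \<le> f q"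
    using continuous_attains_inf[of "K \<times> {0..1}" f] by blast
  obtain x0 l0 where x0: "p = (x0, l0)" by (cases p)
  with p have x0': "x0 \<in> slit_plane" "0 \<le> l0" "l0 \<le> 1" using assms by auto
  have "complex_of_real l0 * x0 + of_real (1 - l0) \<noteq> 0"
  proof
    assume *: "complex_of_real l0 * x0 + of_real (1 - l0) = 0"
    have "l0 \<noteq> 0" using * by auto
    with * have "x0 = of_real (- (1 - l0) / l0)"
      by (simp add: field_simps add_eq_0_iff2)
    moreover have "- (1 - l0) / l0 \<le> 0" using x0' by (simp add: divide_nonpos_nonneg)
    ultimately have "x0 \<in> \<real>\<^sub>\<le>\<^sub>0" unfolding nonpos_Reals_def by blast
    then show False using x0'(1) by (simp add: slit_plane_iff)
  qed
  then have "f p > 0" by (simp add: f_def x0)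
  moreover have "f p * (a + b) \<le> norm (of_real a * x + of_real b)"
    if "x \<in> K" "a \<ge> 0" "b \<ge> 0" for x a b
  proof (cases "a + b = 0")
    case False
    with that have ab: "a + b > 0" by simp
    have eq: "of_real a * x + of_real b =
        of_real (a + b) * (of_real (a / (a + b)) * x + of_real (1 - a / (a + b)))"
    proof -
      have "(a + b) * (a / (a + b)) = a" "(a + b) * (1 - a / (a + b)) = b"
        using ab by (simp_all add: field_simps)
      moreover have "complex_of_real (a + b) * (of_real (a / (a + b)) * x + of_real (1 - a / (a + b)))
          = of_real ((a + b) * (a / (a + b))) * x + of_real ((a + b) * (1 - a / (a + b)))"
        by (simp only: distrib_left of_real_mult mult.assoc)
      ultimately show ?thesis by simp
    qed
    have "f p \<le> f (x, a / (a + b))"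
      using that ab by (intro p(2)) auto
    then have "f p * (a + b) \<le> (a + b) * norm (of_real (a / (a + b)) * x + of_real (1 - a / (a + b)))"
      using ab by (simp add: f_def mult.commute)
    also have "\<dots> = norm (of_real a * x + of_real b)"
      unfolding eq norm_mult using ab by (simp del: of_real_add)
    finally show ?thesis .
  qed simp
  ultimately show ?thesis by (intro exI[of _ "f p"] conjI ballI allI impI)
qed (auto intro: exI[of _ 1])

lemma slit_plane_point_lower_bound:
  assumes "x \<in> slit_plane"
  shows "\<exists>c>0. \<forall>a\<ge>0. \<forall>b\<ge>0. c * (a + b) \<le> norm (of_real a * x + of_real b)"
  using slit_plane_linear_lower_bound[of "{x}"] assms by auto

definition double_term :: "complex \<Rightarrow> complex \<Rightarrow> complex \<Rightarrow> nat \<Rightarrow> nat \<Rightarrow> complex"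
  where "double_term x u v m n = u ^ m * v ^ n / (of_nat m * (of_nat m * x + of_nat n))"

definition double_series :: "complex \<Rightarrow> complex \<Rightarrow> complex \<Rightarrow> complex"
  where "double_series x u v = (\<Sum>\<^sub>\<infinity>(m, n)\<in>{1..} \<times> {1..}. double_term x u v m n)"

definition abel_term :: "complex \<Rightarrow> complex \<Rightarrow> complex \<Rightarrow> nat \<Rightarrow> nat \<Rightarrow> complex"
  where "abel_term x u v m n =
    u ^ m * v ^ n / (of_nat m * (of_nat m * x + of_nat n) * (of_nat m * x + of_nat n + 1))"

text \<open>
  Minus the double series, after summation by parts in \<open>n\<close>. Unlike \<open>double_series\<close>, the sum in
  it converges absolutely on the closed bidisc.
\<close>

definition abel_series :: "complex \<Rightarrow> complex \<Rightarrow> complex \<Rightarrow> complex"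
  where "abel_series x u v =
    v / (1 - v) * ((\<Sum>\<^sub>\<infinity>(m, n)\<in>{1..} \<times> UNIV. abel_term x u v m n) - Li2 u / x)"

lemma slit_plane_linear_nonzero:
  assumes "x \<in> slit_plane" "m > 0"
  shows "of_nat m * x + of_nat n \<noteq> 0" "of_nat m * x + of_nat n + 1 \<noteq> 0"
proof -
  have *: "of_nat m * x + of_nat n \<noteq> 0" for n
  proof -
    obtain c where c: "c > 0"
      "\<And>a b. a \<ge> 0 \<Longrightarrow> b \<ge> 0 \<Longrightarrow> c * (a + b) \<le> norm (of_real a * x + of_real b)"
      using slit_plane_point_lower_bound[OF assms(1)] by blast
    have "0 < c * (real m + real n)" using c(1) assms(2) by simp
    also have "\<dots> \<le> norm (of_nat m * x + of_nat n)" using c(2)[of "real m" "real n"] by simp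
    finally show ?thesis by auto
  qed
  show "of_nat m * x + of_nat n \<noteq> 0" "of_nat m * x + of_nat n + 1 \<noteq> 0"
    using *[of n] *[of "Suc n"] by (simp_all add: add_ac)
qed

text \<open>
  The linear factors are at least \<open>c (m + n)\<close> and \<open>c (n + 1)\<close>, and \<open>m + n \<ge> sqrt (m (n + 1))\<close>
  distributes the decay evenly, so that the majorant is a product of two convergent series.
\<close>

lemma abel_term_bound:
  assumes c: "c > 0" "\<And>a b. a \<ge> 0 \<Longrightarrow> b \<ge> 0 \<Longrightarrow> c * (a + b) \<le> norm (of_real a * x + of_real b)"
    and "norm u \<le> 1" "norm v \<le> 1" "m \<ge> 1"
  shows "norm (abel_term x u v m n) \<le>
    (1 / c\<^sup>2) * (1 / real m powr (3/2) * (1 / real (Suc n) powr (3/2)))"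
proof -
  have "real m powr (3/2) * real (Suc n) powr (3/2)
      = real m * real (Suc n) * sqrt (real m * real (Suc n))"
    using \<open>m \<ge> 1\<close> powr_add[of "real m" 1 "1/2"] powr_add[of "real (Suc n)" 1 "1/2"]
    by (simp add: powr_half_sqrt real_sqrt_mult del: of_nat_Suc)
  also have "\<dots> \<le> real m * real (Suc n) * (real m + real n)"
  proof (rule mult_left_mono)
    have "real m * real (Suc n) \<le> (real m + real n) * (real m + real n)"
      using \<open>m \<ge> 1\<close> by (intro mult_mono) auto
    then show "sqrt (real m * real (Suc n)) \<le> real m + real n"
      by (intro real_le_lsqrt) (auto simp: power2_eq_square)
  qed simp
  also have "\<dots> \<le> real m * (real m + real (Suc n)) * (real m + real n)"
    using \<open>m \<ge> 1\<close> by (intro mult_right_mono mult_left_mono) auto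
  finally have "c\<^sup>2 * (real m powr (3/2) * real (Suc n) powr (3/2)) \<le>
      c\<^sup>2 * (real m * (real m + real (Suc n)) * (real m + real n))"
    by (intro mult_left_mono) (auto simp del: of_nat_Suc)
  also have "\<dots> = real m * (c * (real m + real n)) * (c * (real m + real (Suc n)))"
    by (simp add: power2_eq_square mult_ac)
  also have "\<dots> \<le> real m * norm (of_nat m * x + of_nat n) * norm (of_nat m * x + of_nat (Suc n))"
    using c(1) c(2)[of "real m" "real n"] c(2)[of "real m" "real (Suc n)"]
    by (intro mult_mono mult_nonneg_nonneg) (auto simp del: of_nat_Suc)
  also have "\<dots> = norm (of_nat m * (of_nat m * x + of_nat n) * (of_nat m * x + of_nat n + 1))"
    by (simp add: norm_mult add_ac)
  finally have le: "c\<^sup>2 * (real m powr (3/2) * real (Suc n) powr (3/2)) \<le>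
    norm (of_nat m * (of_nat m * x + of_nat n) * (of_nat m * x + of_nat n + 1))" .
  have "norm (u ^ m * v ^ n) \<le> 1"
    using assms by (simp add: norm_mult norm_power power_le_one mult_le_one)
  then have "norm (abel_term x u v m n) \<le> 1 / (c\<^sup>2 * (real m powr (3/2) * real (Suc n) powr (3/2)))"
    unfolding abel_term_def norm_divide using le c(1) \<open>m \<ge> 1\<close>
    by (intro frac_le) (auto simp del: of_nat_Suc)
  then show ?thesis by simp
qed

lemma abel_bound_summable:
  "(\<lambda>(m, n). (1 / c\<^sup>2) * (1 / real m powr (3/2) * (1 / real (Suc n) powr (3/2))))
     summable_on {1..} \<times> UNIV"
proof -
  have s: "summable (\<lambda>n. 1 / real n powr (3/2))"
    using summable_real_powr_iff[of "-3/2"] by (simp add: powr_minus_divide)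
  then have "(\<lambda>n. 1 / real n powr (3/2)) summable_on UNIV"
    by (subst summable_on_UNIV_nonneg_real_iff) auto
  then have A: "(\<lambda>n. 1 / real n powr (3/2)) summable_on {1..}"
    by (rule summable_on_subset_banach) auto
  from s have "summable (\<lambda>n. 1 / real (Suc n) powr (3/2))" by (subst summable_Suc_iff)
  then have B: "(\<lambda>n. 1 / real (Suc n) powr (3/2)) summable_on UNIV"
    by (subst summable_on_UNIV_nonneg_real_iff) auto
  have "(\<lambda>(m, n). norm (1 / real m powr (3/2)) * norm (1 / real (Suc n) powr (3/2)))
      summable_on {1..} \<times> UNIV"
    using has_sum_product(2)[OF _ has_sum_infsum[OF A] _ has_sum_infsum[OF B]] A B
    by (simp del: of_nat_Suc)
  from summable_on_cmult_right[OF this, of "1 / c\<^sup>2"] show ?thesis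
    by (simp add: case_prod_unfold del: of_nat_Suc)
qed

lemma holomorphic_on_abel_series:
  assumes "norm u \<le> 1" "norm v \<le> 1"
  shows "(\<lambda>x. abel_series x u v) holomorphic_on slit_plane"
proof -
  have "(\<lambda>x. \<Sum>\<^sub>\<infinity>k\<in>{1..} \<times> UNIV. case k of (m, n) \<Rightarrow> abel_term x u v m n) holomorphic_on slit_plane"
  proof (rule holomorphic_on_infsum[OF open_slit_plane])
    show "(\<lambda>x. case k of (m, n) \<Rightarrow> abel_term x u v m n) holomorphic_on slit_plane"
      if "k \<in> {1..} \<times> UNIV" for k
      using that slit_plane_linear_nonzero
      by (cases k) (auto simp: abel_term_def intro!: holomorphic_intros)
  next
    fix K assume K: "compact K" "K \<subseteq> slit_plane"
    obtain c where c: "c > 0"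
      "\<And>x a b. x \<in> K \<Longrightarrow> a \<ge> 0 \<Longrightarrow> b \<ge> 0 \<Longrightarrow> c * (a + b) \<le> norm (of_real a * x + of_real b)"
      using slit_plane_linear_lower_bound[OF K] by blast
    show "\<exists>M. M summable_on {1..} \<times> UNIV \<and>
        (\<forall>k\<in>{1..} \<times> UNIV. \<forall>x\<in>K. norm (case k of (m, n) \<Rightarrow> abel_term x u v m n) \<le> M k)"
    proof (rule exI, rule conjI[OF abel_bound_summable[of c]], intro ballI)
      fix k :: "nat \<times> nat" and x
      assume "k \<in> {1..} \<times> UNIV" "x \<in> K"
      then show "norm (case k of (m, n) \<Rightarrow> abel_term x u v m n) \<le>
          (case k of (m, n) \<Rightarrow> (1 / c\<^sup>2) * (1 / real m powr (3/2) * (1 / real (Suc n) powr (3/2))))"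
        using abel_term_bound[OF c(1) c(2)[OF \<open>x \<in> K\<close>] assms]
        by (cases k) (simp del: of_nat_Suc)
    qed
  qed
  moreover have "(\<lambda>x. Li2 u / x) holomorphic_on slit_plane"
    by (intro holomorphic_on_divide holomorphic_on_const holomorphic_on_ident) (auto simp: slit_plane_iff)
  ultimately have "(\<lambda>x. (\<Sum>\<^sub>\<infinity>k\<in>{1..} \<times> UNIV. case k of (m, n) \<Rightarrow> abel_term x u v m n) - Li2 u / x)
      holomorphic_on slit_plane"
    by (rule holomorphic_on_diff)
  from holomorphic_on_mult[OF holomorphic_on_const[of "v / (1 - v)"] this] show ?thesis
    by (simp only: abel_series_def)
qed

lemma abel_term_has_sum:
  assumes "x \<in> slit_plane" "norm u \<le> 1" "norm v \<le> 1"
  shows "((\<lambda>(m, n). abel_term x u v m n) has_sum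
    (\<Sum>\<^sub>\<infinity>(m, n)\<in>{1..} \<times> UNIV. abel_term x u v m n)) ({1..} \<times> UNIV)"
proof (rule has_sum_infsum)
  obtain c where c: "c > 0"
    "\<And>a b. a \<ge> 0 \<Longrightarrow> b \<ge> 0 \<Longrightarrow> c * (a + b) \<le> norm (of_real a * x + of_real b)"
    using slit_plane_point_lower_bound[OF assms(1)] by blast
  have "(\<lambda>k. norm (case k of (m, n) \<Rightarrow> abel_term x u v m n)) summable_on {1..} \<times> UNIV"
    by (rule Infinite_Sum.abs_summable_on_comparison_test'[OF abel_bound_summable[of c]])
       (use abel_term_bound[OF c assms(2,3)] in
         \<open>simp add: case_prod_unfold mem_Times_iff del: of_nat_Suc\<close>)
  then show "(\<lambda>(m, n). abel_term x u v m n) summable_on {1..} \<times> UNIV"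
    by (rule abs_summable_summable)
qed

lemma continuous_on_abel_series:
  assumes "x \<in> slit_plane"
  shows "continuous_on (cball 0 1 \<times> (cball 0 1 - {1})) (\<lambda>(u, v). abel_series x u v)"
proof -
  obtain c where c: "c > 0"
    "\<And>a b. a \<ge> 0 \<Longrightarrow> b \<ge> 0 \<Longrightarrow> c * (a + b) \<le> norm (of_real a * x + of_real b)"
    using slit_plane_point_lower_bound[OF assms(1)] by blast
  have "continuous_on (cball 0 1 \<times> cball 0 1)
      (\<lambda>p. \<Sum>\<^sub>\<infinity>k\<in>{1..} \<times> UNIV. case k of (m, n) \<Rightarrow> abel_term x (fst p) (snd p) m n)"
  proof (rule continuous_on_infsum[OF _ abel_bound_summable[of c]])
    fix k :: "nat \<times> nat"
    assume k: "k \<in> {1..} \<times> UNIV"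
    then show "continuous_on (cball 0 1 \<times> cball 0 1)
        (\<lambda>p. case k of (m, n) \<Rightarrow> abel_term x (fst p) (snd p) m n)"
      using slit_plane_linear_nonzero[OF assms]
      by (cases k) (auto simp: abel_term_def intro!: continuous_intros)
    fix p :: "complex \<times> complex"
    assume "p \<in> cball 0 1 \<times> cball 0 1"
    then have p: "norm (fst p) \<le> 1" "norm (snd p) \<le> 1" by auto
    show "norm (case k of (m, n) \<Rightarrow> abel_term x (fst p) (snd p) m n) \<le>
        (case k of (m, n) \<Rightarrow> (1 / c\<^sup>2) * (1 / real m powr (3/2) * (1 / real (Suc n) powr (3/2))))"
      using abel_term_bound[OF c p] k
      by (cases k) (simp del: of_nat_Suc)
  qed
  then have "continuous_on (cball 0 1 \<times> (cball 0 1 - {1}))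
      (\<lambda>p. \<Sum>\<^sub>\<infinity>k\<in>{1..} \<times> UNIV. case k of (m, n) \<Rightarrow> abel_term x (fst p) (snd p) m n)"
    by (rule continuous_on_subset) auto
  then show ?thesis
    unfolding abel_series_def case_prod_unfold using assms
    by (intro continuous_intros continuous_on_compose2[OF continuous_on_Li2_disc])
       (auto simp: slit_plane_iff case_prod_unfold)
qed

lemma double_term_summable:
  assumes "x \<in> slit_plane" "norm u < 1" "norm v < 1"
  shows "((\<lambda>(m, n). double_term x u v m n) has_sum double_series x u v) ({1..} \<times> {1..})"
proof -
  obtain c where c: "c > 0"
    "\<And>a b. a \<ge> 0 \<Longrightarrow> b \<ge> 0 \<Longrightarrow> c * (a + b) \<le> norm (of_real a * x + of_real b)"
    using slit_plane_point_lower_bound[OF assms(1)] by blast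
  have geo: "(\<lambda>n. norm (w ^ n)) summable_on {1..}" if "norm w < 1" for w :: complex
  proof -
    have "(\<lambda>n. norm (w ^ n)) summable_on UNIV"
      using that by (subst summable_on_UNIV_nonneg_real_iff) (auto simp: norm_power summable_geometric)
    then show ?thesis by (rule summable_on_subset_banach) auto
  qed
  have "(\<lambda>(m, n). norm (u ^ m) * norm (v ^ n)) summable_on {1..} \<times> {1..}"
    using geo assms abs_summable_summable
    by (intro has_sum_product(2)[OF _ has_sum_infsum _ has_sum_infsum]) blast+
  then have sm: "(\<lambda>(m, n). 1 / c * (norm (u ^ m) * norm (v ^ n))) summable_on {1..} \<times> {1..}"
    using summable_on_cmult_right[of "\<lambda>(m, n). norm (u ^ m) * norm (v ^ n)" _ "1 / c"]
    by (simp add: case_prod_unfold)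
  have bound: "norm (double_term x u v m n) \<le> 1 / c * (norm (u ^ m) * norm (v ^ n))"
    if "m \<ge> 1" "n \<ge> 1" for m n
  proof -
    have "c * 1 \<le> c * (real m + real n)" using c(1) that by (intro mult_left_mono) auto
    also have "\<dots> \<le> norm (of_nat m * x + of_nat n)" using c(2)[of "real m" "real n"] by simp
    finally have "1 * c \<le> real m * norm (of_nat m * x + of_nat n)"
      using c(1) that by (intro mult_mono) auto
    then show ?thesis unfolding double_term_def norm_divide norm_mult
      using frac_le[of "norm (u ^ m) * norm (v ^ n)" _ c] c(1) by simp
  qed
  have "(\<lambda>k. norm (case k of (m, n) \<Rightarrow> double_term x u v m n)) summable_on {1..} \<times> {1..}"
    by (rule Infinite_Sum.abs_summable_on_comparison_test'[OF sm]) (use bound in auto)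
  then show ?thesis unfolding double_series_def
    by (rule has_sum_infsum[OF abs_summable_summable])
qed

lemma image_Suc_UNIV: "range Suc = {1..}"
  by (auto simp: image_def dest: Suc_le_D)

lemma Li2_has_sum:
  assumes "norm u \<le> 1"
  shows "((\<lambda>m. u ^ m / of_nat m ^ 2) has_sum Li2 u) {1..}"
proof -
  have "summable (\<lambda>n. norm (u ^ Suc n / of_nat (Suc n) ^ 2))"
  proof (rule summable_comparison_test)
    show "summable (\<lambda>n. 1 / real (Suc n) ^ 2)"
      using inverse_squares_sums by (simp add: sums_iff add_ac)
    have "norm (u ^ Suc n) \<le> 1" for n using assms by (simp only: norm_power power_le_one norm_ge_zero)
    then show "\<exists>N. \<forall>n\<ge>N. norm (norm (u ^ Suc n / of_nat (Suc n) ^ 2)) \<le> 1 / real (Suc n) ^ 2"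
      by (simp add: norm_divide norm_power divide_right_mono del: of_nat_Suc power_Suc)
  qed
  from norm_summable_imp_has_sum[OF this Li2_series_sums[OF assms]]
  have "((\<lambda>m. u ^ m / of_nat m ^ 2) \<circ> Suc has_sum Li2 u) UNIV"
    using assms by (simp add: o_def Li2_eq_series del: of_nat_Suc)
  then show ?thesis using has_sum_reindex[of Suc UNIV "\<lambda>m. u ^ m / of_nat m ^ 2"]
    by (simp only: image_Suc_UNIV) simp
qed

lemma ln_has_sum:
  fixes u :: complex
  assumes "norm u < 1"
  shows "((\<lambda>m. u ^ m / of_nat m) has_sum - ln (1 - u)) {1..}"
    and "(\<lambda>m. norm (u ^ m / of_nat m)) summable_on {1..}"
proof -
  have "(\<lambda>m. - (u ^ m) / of_nat m) sums ln (1 - u)"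
    using Ln_series'[of "-u"] assms by simp
  from sums_minus[OF this] have s: "(\<lambda>m. u ^ m / of_nat m) sums - ln (1 - u)" by simp
  have n: "summable (\<lambda>m. norm (u ^ m / of_nat m))"
  proof (rule summable_comparison_test)
    show "summable (\<lambda>m. norm u ^ m)" using assms by (simp add: summable_geometric)
    show "\<exists>N. \<forall>m\<ge>N. norm (norm (u ^ m / of_nat m)) \<le> norm u ^ m"
      by (intro exI[of _ 1]) (auto simp: norm_divide norm_power divide_le_eq mult_le_cancel_left1)
  qed
  from norm_summable_imp_has_sum[OF n s]
  show "((\<lambda>m. u ^ m / of_nat m) has_sum - ln (1 - u)) {1..}"
    by (rule has_sum_cong_neutral[THEN iffD1, rotated -1]) auto
  from n have "(\<lambda>m. norm (u ^ m / of_nat m)) summable_on UNIV"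
    by (subst summable_on_UNIV_nonneg_real_iff) auto
  then show "(\<lambda>m. norm (u ^ m / of_nat m)) summable_on {1..}"
    by (rule summable_on_subset_banach) auto
qed

text \<open>
  Summation by parts in \<open>n\<close>: multiplying the inner sum of the double series by \<open>1 - v\<close> replaces
  \<open>1 / (m x + n)\<close> by a difference of consecutive terms. The boundary terms at \<open>n = 0\<close> are
  multiples of \<open>u\<^sup>m / (m\<^sup>2 x)\<close> and give the dilogarithm.
\<close>

lemma abel_series_eq_double_series:
  assumes x: "x \<in> slit_plane" and u: "norm u < 1" and v: "norm v < 1"
  shows "abel_series x u v = - double_series x u v"
proof -
  let ?T = "\<Sum>\<^sub>\<infinity>(m, n)\<in>{1..} \<times> UNIV. abel_term x u v m n"
  define \<beta> where "\<beta> m = (\<Sum>\<^sub>\<infinity>n\<in>{1..}. double_term x u v m n)" for m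
  define \<tau> where "\<tau> m = (\<Sum>\<^sub>\<infinity>n. abel_term x u v m n)" for m
  note D = double_term_summable[OF x u v]
  note T = abel_term_has_sum[OF x less_imp_le[OF u] less_imp_le[OF v]]
  have \<beta>: "((\<lambda>n. double_term x u v m n) has_sum \<beta> m) {1..}" if "m \<in> {1..}" for m
    using summable_on_SigmaD1[OF _ that, of "double_term x u v" "\<lambda>_. {1..}"] D
    unfolding \<beta>_def by (auto intro: has_sum_infsum simp: has_sum_imp_summable)
  have \<tau>: "((\<lambda>n. abel_term x u v m n) has_sum \<tau> m) UNIV" if "m \<in> {1..}" for m
    using summable_on_SigmaD1[OF _ that, of "abel_term x u v" "\<lambda>_. UNIV"] T
    unfolding \<tau>_def by (auto intro: has_sum_infsum simp: has_sum_imp_summable)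
  have \<beta>_sum: "(\<beta> has_sum double_series x u v) {1..}"
    by (rule has_sum_SigmaD[OF D]) (simp only: split \<beta>)
  have \<tau>_sum: "(\<tau> has_sum ?T) {1..}"
    by (rule has_sum_SigmaD[OF T]) (simp only: split \<tau>)
  have rel: "v * \<tau> m = - (1 - v) * \<beta> m + v / x * (u ^ m / of_nat m ^ 2)" if m: "m \<in> {1..}" for m
  proof -
    have m0: "m > 0" using m by simp
    note nz = slit_plane_linear_nonzero[OF x m0]
    let ?e = "double_term x u v m"
    have "(?e has_sum \<beta> m + ?e 0) (insert 0 {1..})"
      using has_sum_insert[of 0 "{1..}" ?e "\<beta> m"] \<beta>[OF m] by (simp add: add.commute)
    also have "insert 0 {1..} = (UNIV :: nat set)" by auto
    finally have e0: "(?e has_sum \<beta> m + ?e 0) UNIV" .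
    have "((\<lambda>n. ?e (Suc n)) has_sum \<beta> m) UNIV"
      using \<beta>[OF m] has_sum_reindex[of Suc UNIV ?e] by (simp only: image_Suc_UNIV) (simp add: o_def)
    from has_sum_diff[OF has_sum_cmult_right[OF e0, of v] this]
    have "((\<lambda>n. v * ?e n - ?e (Suc n)) has_sum v * (\<beta> m + ?e 0) - \<beta> m) UNIV" .
    moreover have "v * ?e n - ?e (Suc n) = v * abel_term x u v m n" for n
      using nz[of n] m0 by (simp add: double_term_def abel_term_def divide_simps add_ac)
        (simp add: algebra_simps)
    ultimately have "v * \<tau> m = v * (\<beta> m + ?e 0) - \<beta> m"
      using has_sum_cmult_right[OF \<tau>[OF m], of v] has_sum_unique by fastforce
    then show ?thesis
      by (simp add: double_term_def algebra_simps power2_eq_square)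
  qed
  have "((\<lambda>m. v * \<tau> m) has_sum v * ?T) {1..}"
    by (rule has_sum_cmult_right[OF \<tau>_sum])
  moreover have "((\<lambda>m. - (1 - v) * \<beta> m + v / x * (u ^ m / of_nat m ^ 2)) has_sum
      - (1 - v) * double_series x u v + v / x * Li2 u) {1..}"
    using u by (intro has_sum_add has_sum_cmult_right \<beta>_sum Li2_has_sum) auto
  then have "((\<lambda>m. v * \<tau> m) has_sum - (1 - v) * double_series x u v + v / x * Li2 u) {1..}"
    by (rule has_sum_cong[THEN iffD1, rotated]) (simp add: rel)
  ultimately have "v * ?T = - (1 - v) * double_series x u v + v / x * Li2 u"
    by (rule has_sum_unique)
  moreover have "1 - v \<noteq> 0" using v by auto
  ultimately show ?thesis
    unfolding abel_series_def by (simp add: field_simps)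
qed

text \<open>
  The terms at \<open>(m, n)\<close> and \<open>(n, m)\<close> add up to \<open>(m x + n) / (m n (m x + n))\<close> times \<open>u\<^sup>m v\<^sup>n\<close>,
  and the linear factor cancels.
\<close>

lemma double_series_reflection:
  assumes x: "x \<in> slit_plane" and u: "norm u < 1" and v: "norm v < 1"
  shows "double_series x u v + double_series (1 / x) v u = ln (1 - u) * ln (1 - v)"
proof -
  have x': "1 / x \<in> slit_plane" using slit_plane_inverse[OF x] by (simp add: inverse_eq_divide)
  have x0: "x \<noteq> 0" using x by (auto simp: slit_plane_iff)
  have "((\<lambda>(m, n). double_term (1 / x) v u n m) has_sum double_series (1 / x) v u) ({1..} \<times> {1..})"
    using double_term_summable[OF x' v u] has_sum_swap[of "\<lambda>(m, n). double_term (1 / x) v u m n"]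
    by simp
  from has_sum_add[OF double_term_summable[OF x u v] this]
  have "((\<lambda>(m, n). double_term x u v m n + double_term (1 / x) v u n m) has_sum
      double_series x u v + double_series (1 / x) v u) ({1..} \<times> {1..})"
    by (simp add: case_prod_unfold)
  moreover have "((\<lambda>(m, n). (u ^ m / of_nat m) * (v ^ n / of_nat n)) has_sum
      (- ln (1 - u)) * (- ln (1 - v))) ({1..} \<times> {1..})"
    by (rule has_sum_product(1)) (use ln_has_sum u v in auto)
  moreover have "double_term x u v m n + double_term (1 / x) v u n m
      = (u ^ m / of_nat m) * (v ^ n / of_nat n)" if "m \<ge> 1" "n \<ge> 1" for m n
  proof -
    have "double_term (1 / x) v u n m = u ^ m * v ^ n * x / (of_nat n * (of_nat m * x + of_nat n))"
      using x0 by (simp add: double_term_def divide_simps) (simp add: algebra_simps)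
    moreover have "a * b / (M * (M * x + N)) + a * b * x / (N * (M * x + N)) = (a / M) * (b / N)"
      if "M \<noteq> 0" "N \<noteq> 0" "M * x + N \<noteq> 0" for a b M N :: complex
      using that by (simp add: divide_simps) (simp add: algebra_simps)
    ultimately show ?thesis
      using that slit_plane_linear_nonzero(1)[OF x, of m n] by (simp add: double_term_def)
  qed
  then have "((\<lambda>(m, n). double_term x u v m n + double_term (1 / x) v u n m) has_sum
      (- ln (1 - u)) * (- ln (1 - v))) ({1..} \<times> {1..}) \<longleftrightarrow>
      ((\<lambda>(m, n). (u ^ m / of_nat m) * (v ^ n / of_nat n)) has_sum
      (- ln (1 - u)) * (- ln (1 - v))) ({1..} \<times> {1..})"
    by (intro has_sum_cong) auto
  ultimately have "double_series x u v + double_series (1 / x) v u = (- ln (1 - u)) * (- ln (1 - v))"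
    using has_sum_unique by blast
  then show ?thesis by simp
qed

text \<open>
  The maps \<open>?\<alpha>\<close>, \<open>?\<delta>\<close>, \<open>?\<gamma>\<close> parametrise the index pairs with \<open>m < n\<close>, \<open>m = n\<close> and \<open>m > n\<close>. By
  partial fractions, the coefficient at \<open>(m + n, n)\<close> is the difference of those at \<open>(m, n)\<close> of
  the series at \<open>x / (x + 1)\<close> and at \<open>1\<close>.
\<close>

lemma double_series_three_term:
  assumes x: "x \<in> slit_plane" and u: "norm u < 1" and v: "norm v < 1"
  shows "double_series x u v - double_series (x + 1) (u * v) v - double_series (x / (x + 1)) u (u * v)
    = Li2 (u * v) / (x + 1) - double_series 1 u (u * v)"
proof -
  have uv: "norm (u * v) < 1"
    using norm_mult_less[OF u v] by simp
  let ?P = "{1..} \<times> {1..} :: (nat \<times> nat) set"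
  let ?f = "\<lambda>(m, n). double_term x u v m n"
  let ?\<alpha> = "\<lambda>(m, n). (m, m + n) :: nat \<times> nat" and ?\<gamma> = "\<lambda>(m, n). (m + n, n) :: nat \<times> nat"
    and ?\<delta> = "\<lambda>m. (m, m) :: nat \<times> nat"
  note x1 = slit_plane_add_1[OF x] and x2 = slit_plane_moebius[OF x]
  have x1_nz: "x + 1 \<noteq> 0" using x1 by (auto simp: slit_plane_iff)
  have one: "1 \<in> slit_plane" by (simp add: slit_plane_iff)
  have above: "(?f has_sum double_series (x + 1) (u * v) v) (?\<alpha> ` ?P)"
  proof (subst has_sum_reindex)
    have "(?f \<circ> ?\<alpha>) (m, n) = double_term (x + 1) (u * v) v m n" for m n
      by (simp add: double_term_def power_mult_distrib power_add algebra_simps)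
    then show "(?f \<circ> ?\<alpha> has_sum double_series (x + 1) (u * v) v) ?P"
      using double_term_summable[OF x1 uv v] by (auto simp: case_prod_unfold fun_eq_iff o_def)
  qed (auto simp: inj_on_def)
  have diagonal: "(?f has_sum Li2 (u * v) / (x + 1)) (?\<delta> ` {1..})"
  proof (subst has_sum_reindex)
    have "(?f \<circ> ?\<delta>) m = (u * v) ^ m / of_nat m ^ 2 * (1 / (x + 1))" for m
    proof -
      have "of_nat m * x + of_nat m = of_nat m * (x + 1)" by (simp add: algebra_simps)
      then show ?thesis by (simp add: double_term_def power_mult_distrib power2_eq_square)
    qed
    then show "(?f \<circ> ?\<delta> has_sum Li2 (u * v) / (x + 1)) {1..}"
      using has_sum_cmult_left[OF Li2_has_sum[OF less_imp_le[OF uv]], of "1 / (x + 1)"]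
      by (simp add: fun_eq_iff o_def)
  qed (auto simp: inj_on_def)
  have below: "(?f has_sum double_series (x / (x + 1)) u (u * v) - double_series 1 u (u * v)) (?\<gamma> ` ?P)"
  proof (subst has_sum_reindex)
    have "(?f \<circ> ?\<gamma>) (m, n) = double_term (x / (x + 1)) u (u * v) m n - double_term 1 u (u * v) m n"
      if "m \<ge> 1" "n \<ge> 1" for m n
    proof -
      have "of_nat (m + n) * x + of_nat n \<noteq> 0"
        using slit_plane_linear_nonzero(1)[OF x, of "m + n" n] that by simp
      then have nz: "of_nat m * x + of_nat n * (x + 1) \<noteq> 0" by (simp add: algebra_simps)
      have mn: "of_nat m + of_nat n \<noteq> (0 :: complex)" "of_nat m \<noteq> (0 :: complex)"
        using that by (simp_all flip: of_nat_add)
      have "double_term (x / (x + 1)) u (u * v) m n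
          = u ^ (m + n) * v ^ n * ((x + 1) / (of_nat m * (of_nat m * x + of_nat n * (x + 1))))"
      proof -
        have "of_nat m * (x / (x + 1)) + of_nat n = (of_nat m * x + of_nat n * (x + 1)) / (x + 1)"
          using x1_nz by (simp add: field_simps)
        then show ?thesis by (simp add: double_term_def power_mult_distrib power_add)
      qed
      moreover have "double_term 1 u (u * v) m n
          = u ^ (m + n) * v ^ n * (1 / (of_nat m * (of_nat m + of_nat n)))"
        by (simp add: double_term_def power_mult_distrib power_add)
      moreover have "(?f \<circ> ?\<gamma>) (m, n)
          = u ^ (m + n) * v ^ n * (1 / ((of_nat m + of_nat n) * (of_nat m * x + of_nat n * (x + 1))))"
        by (simp add: double_term_def algebra_simps)
      moreover have "1 / ((of_nat m + of_nat n) * (of_nat m * x + of_nat n * (x + 1)))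
          = (x + 1) / (of_nat m * (of_nat m * x + of_nat n * (x + 1)))
            - 1 / (of_nat m * (of_nat m + of_nat n))"
        using nz mn by (simp add: divide_simps) (simp add: algebra_simps)
      ultimately show ?thesis by (simp add: right_diff_distrib)
    qed
    then have "(?f \<circ> ?\<gamma> has_sum double_series (x / (x + 1)) u (u * v) - double_series 1 u (u * v)) ?P
      \<longleftrightarrow> ((\<lambda>p. (case p of (m, n) \<Rightarrow> double_term (x / (x + 1)) u (u * v) m n)
            - (case p of (m, n) \<Rightarrow> double_term 1 u (u * v) m n)) has_sum
          double_series (x / (x + 1)) u (u * v) - double_series 1 u (u * v)) ?P"
      by (intro has_sum_cong) auto
    then show "(?f \<circ> ?\<gamma> has_sum double_series (x / (x + 1)) u (u * v) - double_series 1 u (u * v)) ?P"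
      using has_sum_diff[OF double_term_summable[OF x2 u uv] double_term_summable[OF one u uv]]
      by simp
  qed (auto simp: inj_on_def)
  have P: "?P = ?\<alpha> ` ?P \<union> ?\<delta> ` {1..} \<union> ?\<gamma> ` ?P"
  proof
    show "?P \<subseteq> ?\<alpha> ` ?P \<union> ?\<delta> ` {1..} \<union> ?\<gamma> ` ?P"
    proof
      fix p assume "p \<in> ?P"
      then obtain m n where p: "p = (m, n)" "m \<ge> 1" "n \<ge> 1" by auto
      consider "m < n" | "m = n" | "n < m" by linarith
      then show "p \<in> ?\<alpha> ` ?P \<union> ?\<delta> ` {1..} \<union> ?\<gamma> ` ?P"
      proof cases
        case 1
        then have "p = ?\<alpha> (m, n - m)" "(m, n - m) \<in> ?P" using p by auto
        then show ?thesis by blast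
      next
        case 2
        then show ?thesis using p by auto
      next
        case 3
        then have "p = ?\<gamma> (m - n, n)" "(m - n, n) \<in> ?P" using p by auto
        then show ?thesis by blast
      qed
    qed
  qed auto
  have disj: "?\<alpha> ` ?P \<inter> ?\<delta> ` {1..} = {}" "(?\<alpha> ` ?P \<union> ?\<delta> ` {1..}) \<inter> ?\<gamma> ` ?P = {}"
    by auto
  let ?rhs = "double_series (x + 1) (u * v) v + Li2 (u * v) / (x + 1)
      + (double_series (x / (x + 1)) u (u * v) - double_series 1 u (u * v))"
  have "(?f has_sum ?rhs) (?\<alpha> ` ?P \<union> ?\<delta> ` {1..} \<union> ?\<gamma> ` ?P)"
    by (rule has_sum_Un_disjoint[OF has_sum_Un_disjoint[OF above diagonal disj(1)] below disj(2)])
  then have "(?f has_sum ?rhs) ?P"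
    by (rule back_subst[where P = "\<lambda>A. (?f has_sum ?rhs) A", OF _ P[symmetric]])
  then have eq: "double_series x u v = ?rhs"
    by (rule has_sum_unique[OF double_term_summable[OF x u v]])
  have "a + l + (c - d) - a - c = l - d" for a l c d :: complex by simp
  then show ?thesis unfolding eq .
qed

section \<open>The integral\<close>

lemma powr_power_real: "m > 0 \<Longrightarrow> (of_real t powr x) ^ m = of_real t powr (of_nat m * x :: complex)"
  by (cases "t = 0") (simp_all add: powr_def mult_ac flip: exp_of_nat_mult)

lemma norm_powr_le_1:
  assumes "0 \<le> t" "t \<le> 1" "Re x > 0"
  shows "norm (of_real t powr x) \<le> 1"
  using assms by (simp add: norm_powr_real_powr powr_le1)

lemma continuous_on_of_real_powr:
  fixes x :: complex
  assumes "Re x > 0"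
  shows "continuous_on {0..1} (\<lambda>t. of_real t powr x)"
  using assms by (intro continuous_on_powr_complex continuous_intros) auto

lemma has_integral_powr_power:
  assumes "Re x > 0" "m > 0" "n > 0"
  shows "((\<lambda>t. of_real t powr (of_nat m * x) * of_real t ^ (n - 1)) has_integral
    1 / (of_nat m * x + of_nat n)) {0..1}"
proof -
  define s where "s = of_nat m * x + of_nat n"
  have "Re s > 0" using assms by (simp add: s_def add_pos_pos)
  then have s0: "s \<noteq> 0" by auto
  have "((\<lambda>t. of_real t powr (of_nat m * x) * of_real t ^ (n - 1)) has_integral
      of_real 1 powr s / s - of_real 0 powr s / s) {0..1}"
  proof (rule fundamental_theorem_of_calculus_interior)
    show "continuous_on {0..1} (\<lambda>t. of_real t powr s / s)"
      using s0 by (intro continuous_intros continuous_on_of_real_powr \<open>Re s > 0\<close>) auto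
    fix t :: real
    assume t: "t \<in> {0<..<1}"
    have "((\<lambda>z. z powr s / s) has_field_derivative s * of_real t powr (s - 1) / s) (at (of_real t))"
      using t by (intro DERIV_cdivide has_field_derivative_powr) (simp add: complex_nonpos_Reals_iff)
    also have "s * of_real t powr (s - 1) / s = of_real t powr (s - 1)" using s0 by simp
    also have "complex_of_real t powr (s - 1) = of_real t powr (of_nat m * x) * of_real t ^ (n - 1)"
    proof -
      have "s - 1 = of_nat m * x + of_nat (n - 1)" using assms(3) by (simp add: s_def of_nat_diff)
      then show ?thesis using t by (simp add: powr_add powr_nat')
    qed
    finally show "((\<lambda>t. of_real t powr s / s) has_vector_derivative
        of_real t powr (of_nat m * x) * of_real t ^ (n - 1)) (at t)"
      by (rule has_vector_derivative_real_field)
  qed simp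
  then show ?thesis by (simp add: s_def)
qed

lemma geometric_has_sum:
  fixes w :: complex
  assumes "norm w < 1"
  shows "((\<lambda>n. w ^ (n - 1)) has_sum 1 / (1 - w)) {1..}"
    and "(\<lambda>n. norm (w ^ (n - 1))) summable_on {1..}"
proof -
  have s: "summable (\<lambda>n. norm (w ^ n))" using assms by (simp add: norm_power summable_geometric)
  have "((\<lambda>n. w ^ n) has_sum 1 / (1 - w)) UNIV"
    by (rule norm_summable_imp_has_sum[OF s geometric_sums[OF assms]])
  then show "((\<lambda>n. w ^ (n - 1)) has_sum 1 / (1 - w)) {1..}"
    using has_sum_reindex[of Suc UNIV "\<lambda>n. w ^ (n - 1)"]
    by (simp only: image_Suc_UNIV) (simp add: o_def)
  have "(\<lambda>n. norm (w ^ n)) summable_on UNIV"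
    using s by (subst summable_on_UNIV_nonneg_real_iff) auto
  then show "(\<lambda>n. norm (w ^ (n - 1))) summable_on {1..}"
    using summable_on_reindex[of Suc UNIV "\<lambda>n. norm (w ^ (n - 1))"]
    by (simp only: image_Suc_UNIV) (simp add: o_def)
qed

lemma HZN_integrand_eq:
  assumes "v \<noteq> (0 :: complex)"
  shows "a / (inverse v - t) = a * (v / (1 - v * t))"
proof (cases "1 - v * t = 0")
  case True
  then have "inverse v - t = 0" using assms by (simp add: field_simps)
  then show ?thesis using True by simp
next
  case False
  then have "inverse v - t \<noteq> 0" using assms by (auto simp: field_simps)
  then show ?thesis using False assms by (simp add: field_simps)
qed

text \<open>
  Expand the logarithm and the geometric series. The product converges uniformly in \<open>t\<close>, with
  majorant \<open>|u|\<^sup>m |v|\<^sup>n / m\<close>, and may be integrated termwise.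
\<close>

lemma HZN_integral_eq_double_series:
  assumes x: "Re x > 0" and u: "norm u < 1" and v: "norm v < 1" "v \<noteq> 0"
  shows "HZN_integral x u v = - double_series x u v"
proof -
  let ?P = "{1..} \<times> {1..} :: (nat \<times> nat) set"
  define g where "g = (\<lambda>(m, n) t::real. u ^ m / of_nat m * v ^ n *
    (of_real t powr (of_nat m * x) * of_real t ^ (n - 1)))"
  define S where "S = (\<lambda>t::real. - ln (1 - u * of_real t powr x) * (v / (1 - v * of_real t)))"
  have sum: "((\<lambda>k. g k t) has_sum S t) ?P" if t: "t \<in> {0..1}" for t
  proof -
    have scale: "norm (w * z) < 1" if "norm w < 1" "norm z \<le> 1" for w z :: complex
      using mult_left_le[OF that(2) norm_ge_zero[of w]] that(1) by (simp only: norm_mult)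
    have ut: "norm (u * of_real t powr x) < 1" and vt: "norm (v * of_real t) < 1"
      using t x u v by (auto intro!: scale norm_powr_le_1)
    have "((\<lambda>(m, n). (u * of_real t powr x) ^ m / of_nat m * (v * (v * of_real t) ^ (n - 1)))
        has_sum (- ln (1 - u * of_real t powr x)) * (v * (1 / (1 - v * of_real t)))) ?P"
    proof (rule has_sum_product(1))
      show "((\<lambda>n. v * (v * of_real t) ^ (n - 1)) has_sum v * (1 / (1 - v * of_real t))) {1..}"
        by (intro has_sum_cmult_right geometric_has_sum vt)
      show "(\<lambda>n. norm (v * (v * of_real t) ^ (n - 1))) summable_on {1..}"
        using summable_on_cmult_right[OF geometric_has_sum(2)[OF vt], of "norm v"]
        by (simp only: norm_mult)
    qed (use ln_has_sum[OF ut] in auto)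
    moreover have "(u * of_real t powr x) ^ m / of_nat m * (v * (v * of_real t) ^ (n - 1)) = g (m, n) t"
      if "m \<ge> 1" "n \<ge> 1" for m n
    proof -
      have "v * (v * of_real t) ^ (n - 1) = v ^ n * of_real t ^ (n - 1)"
        using that(2) by (cases n) (simp_all add: power_mult_distrib)
      moreover have "(u * of_real t powr x) ^ m = u ^ m * of_real t powr (of_nat m * x)"
        using that(1) by (simp add: power_mult_distrib powr_power_real)
      ultimately show ?thesis by (simp add: g_def)
    qed
    then have "((\<lambda>k. g k t) has_sum s) ?P \<longleftrightarrow>
        ((\<lambda>(m, n). (u * of_real t powr x) ^ m / of_nat m * (v * (v * of_real t) ^ (n - 1))) has_sum s) ?P" for s
      by (intro has_sum_cong) auto
    ultimately show ?thesis by (simp add: S_def)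
  qed
  have bound: "norm (g (m, n) t) \<le> norm (u ^ m / of_nat m) * norm (v ^ n)"
    if "m \<ge> 1" "t \<in> {0..1}" for m n t
  proof -
    have "Re (of_nat m * x) > 0" using x that(1) by simp
    then have "norm (of_real t powr (of_nat m * x)) * norm (of_real t ^ (n - 1) :: complex) \<le> 1 * 1"
      using that(2) by (intro mult_mono norm_powr_le_1) (auto simp: norm_power power_le_one)
    from mult_left_mono[OF this, of "norm (u ^ m / of_nat m * v ^ n)"] show ?thesis
      by (simp add: g_def norm_mult norm_divide mult_ac)
  qed
  have "(\<lambda>n. norm (v * v ^ (n - 1))) summable_on {1..}"
    using summable_on_cmult_right[OF geometric_has_sum(2)[OF v(1)], of "norm v"]
    by (simp only: norm_mult)
  then have "(\<lambda>n. norm (v ^ n)) summable_on {1..}"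
    by (rule summable_on_cong[THEN iffD1, rotated]) (auto simp: norm_mult norm_power gr0_conv_Suc Suc_le_eq)
  then have M: "(\<lambda>(m, n). norm (u ^ m / of_nat m) * norm (v ^ n)) summable_on ?P"
    using ln_has_sum[OF u]
    by (intro has_sum_product(2)[OF _ _ _ has_sum_infsum[OF abs_summable_summable]]) auto
  have lim: "uniform_limit {0..1} (\<lambda>X t. \<Sum>k\<in>X. g k t) S (finite_subsets_at_top ?P)"
    by (rule Weierstrass_m_test_general'[OF _ sum M]) (use bound in auto)
  have cont: "continuous_on {0..1} (\<lambda>t. \<Sum>k\<in>X. g k t)" for X
  proof (intro continuous_on_sum)
    fix k :: "nat \<times> nat"
    obtain m n where k: "k = (m, n)" by (cases k)
    (* X may contain indices outside the summation range; for m = 0 the division by 0 makes the term 0 *)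
    show "continuous_on {0..1} (g k)"
    proof (cases "m = 0")
      case False
      then show ?thesis unfolding k g_def split using x
        by (intro continuous_intros continuous_on_of_real_powr) auto
    qed (simp add: k g_def)
  qed
  obtain I J where I: "\<And>X. ((\<lambda>t. \<Sum>k\<in>X. g k t) has_integral I X) {0..1}"
    and J: "(S has_integral J) {0..1}" and IJ: "(I \<longlongrightarrow> J) (finite_subsets_at_top ?P)"
    by (rule uniform_limit_integral[OF lim cont finite_subsets_at_top_neq_bot]) (rule that)
  have "I X = (\<Sum>(m, n)\<in>X. double_term x u v m n)" if X: "finite X" "X \<subseteq> ?P" for X
  proof -
    have "((\<lambda>t. \<Sum>k\<in>X. g k t) has_integral (\<Sum>(m, n)\<in>X. double_term x u v m n)) {0..1}"
    proof (rule has_integral_sum[OF X(1)])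
      fix k assume "k \<in> X"
      then obtain m n where k: "k = (m, n)" "m > 0" "n > 0" using X(2) by force
      from has_integral_mult_right[OF has_integral_powr_power[OF x k(2,3)], of "u ^ m / of_nat m * v ^ n"]
      show "(g k has_integral (case k of (m, n) \<Rightarrow> double_term x u v m n)) {0..1}"
        by (simp add: k(1) g_def double_term_def)
    qed
    then show ?thesis using I[of X] has_integral_unique by blast
  qed
  then have "eventually (\<lambda>X. I X = (\<Sum>(m, n)\<in>X. double_term x u v m n)) (finite_subsets_at_top ?P)"
    by (intro eventually_finite_subsets_at_top_weakI)
  then have "((\<lambda>X. \<Sum>(m, n)\<in>X. double_term x u v m n) \<longlongrightarrow> J) (finite_subsets_at_top ?P)"
    by (rule Lim_transform_eventually[OF IJ])
  moreover have "x \<in> slit_plane" using x right_half_plane_subset_slit_plane by auto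
  note double_term_summable[OF this u v(1)]
  ultimately have "J = double_series x u v"
    using tendsto_unique[OF finite_subsets_at_top_neq_bot] unfolding has_sum_def by blast
  moreover have "HZN_integral x u v = - J"
  proof -
    have "((\<lambda>t. - S t) has_integral - J) {0..1}" by (rule has_integral_neg[OF J])
    then show ?thesis unfolding HZN_integral_def HZN_integrand_eq[OF v(2)]
      by (intro integral_unique) (simp add: S_def)
  qed
  ultimately show ?thesis by simp
qed

text \<open>
  With all three factors in the closed disc the product can only be 1 if each factor has norm
  1; then \<open>r = 1\<close> and \<open>z = 1\<close>, so it equals \<open>u\<close>.
\<close>

lemma scaled_ne_1:
  fixes u z :: complex
  assumes "norm u \<le> 1" "u \<noteq> 1" "0 \<le> r" "r \<le> 1" "norm z \<le> 1" "norm z = 1 \<Longrightarrow> z = 1"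
  shows "of_real r * u * z \<noteq> 1" "norm (of_real r * u * z) \<le> 1"
proof -
  have uz: "norm (u * z) \<le> 1" using assms by (simp add: norm_mult mult_le_one)
  then show "norm (of_real r * u * z) \<le> 1"
    using assms by (simp add: norm_mult mult_le_one mult.assoc)
  show "of_real r * u * z \<noteq> 1"
  proof
    assume eq: "of_real r * u * z = 1"
    then have "r * norm (u * z) = 1"
      using assms(3) by (metis abs_of_nonneg mult.assoc norm_mult norm_of_real norm_one)
    moreover have "r * norm (u * z) \<le> r" using uz assms(3) by (simp add: mult_left_le)
    ultimately have r: "r = 1" using assms(4) by simp
    with \<open>r * norm (u * z) = 1\<close> have "norm u * norm z = 1" by (simp add: norm_mult)
    moreover have "norm u * norm z \<le> 1 * norm z" using assms by (intro mult_right_mono) auto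
    ultimately have "norm z = 1" using assms by simp
    then have "z = 1" by (rule assms(6))
    with eq r assms(2) show False by simp
  qed
qed

text \<open>
  Since neither \<open>u\<close> nor \<open>v\<close> is 1, the integrand is continuous in \<open>(r, t)\<close> up to \<open>r = t = 1\<close>, so
  its integral is continuous in \<open>r\<close>.
\<close>

lemma HZN_integral_radial_limit:
  assumes x: "Re x > 0" and u: "u \<in> punctured_disc'" and v: "v \<in> punctured_disc'"
  shows "((\<lambda>r. HZN_integral x (of_real r * u) (of_real r * v)) \<longlongrightarrow> HZN_integral x u v) (at_left 1)"
proof -
  have u': "norm u \<le> 1" "u \<noteq> 1" and v': "norm v \<le> 1" "v \<noteq> 1" "v \<noteq> 0"
    using u v by (auto simp: punctured_disc'_def punctured_disc_def)
  have A: "Re (1 - of_real r * u * of_real t powr x) > 0"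
    "inverse (of_real r * v) - of_real t \<noteq> 0"
    if r: "r \<in> {1/2..1}" and t: "t \<in> {0..1}" for r t
  proof -
    have "of_real t powr x = 1" if "norm (of_real t powr x) = 1"
    proof -
      have "t powr Re x = 1" using that t by (simp add: norm_powr_real_powr)
      then have "t = 1" using t x by (auto simp: powr_eq_one_iff_gen powr_def split: if_splits)
      then show ?thesis by simp
    qed
    then show "Re (1 - of_real r * u * of_real t powr x) > 0"
      using r t x u' by (intro Re_one_minus_pos scaled_ne_1 norm_powr_le_1) auto
    have "of_real r * v * of_real t \<noteq> 1"
      using r t v' by (intro scaled_ne_1) auto
    then show "inverse (of_real r * v) - of_real t \<noteq> 0"
      using r v' by (auto simp: field_simps)
  qed
  have "continuous_on ({1/2..1} \<times> cbox 0 1) (\<lambda>(r, t::real).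
      ln (1 - of_real r * u * of_real t powr x) / (inverse (of_real r * v) - of_real t))"
    unfolding case_prod_unfold
  proof (intro continuous_on_divide continuous_on_Ln' ballI)
    have "continuous_on ({1/2..1} \<times> cbox 0 1) (\<lambda>p. complex_of_real (snd p) powr x)"
      by (rule continuous_on_compose2[OF continuous_on_of_real_powr[OF x] continuous_on_snd[OF continuous_on_id]])
        auto
    then show "continuous_on ({1/2..1} \<times> cbox 0 1)
        (\<lambda>p. 1 - of_real (fst p) * u * complex_of_real (snd p) powr x)"
      by (intro continuous_on_diff continuous_on_mult continuous_on_const continuous_on_of_real
          continuous_on_fst continuous_on_id)
    show "continuous_on ({1/2..1} \<times> cbox 0 1)
        (\<lambda>p. inverse (of_real (fst p) * v) - complex_of_real (snd p))"
      using v' by (intro continuous_intros) auto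
  next
    fix p :: "real \<times> real"
    assume "p \<in> {1/2..1} \<times> cbox 0 1"
    then have p: "fst p \<in> {1/2..1}" "snd p \<in> {0..1}" by auto
    show "1 - of_real (fst p) * u * of_real (snd p) powr x \<notin> \<real>\<^sub>\<le>\<^sub>0"
      using A(1)[OF p] by (auto simp: complex_nonpos_Reals_iff)
    show "inverse (of_real (fst p) * v) - of_real (snd p) \<noteq> 0"
      by (rule A(2)[OF p])
  qed
  then have "continuous_on {1/2..1} (\<lambda>r. integral (cbox 0 1) (\<lambda>t::real.
      ln (1 - of_real r * u * of_real t powr x) / (inverse (of_real r * v) - of_real t)))"
    by (rule integral_continuous_on_param)
  then have "continuous_on {1/2..1} (\<lambda>r. HZN_integral x (of_real r * u) (of_real r * v))"
    by (simp only: HZN_integral_def cbox_interval)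
  then have "((\<lambda>r. HZN_integral x (of_real r * u) (of_real r * v)) \<longlongrightarrow>
      HZN_integral x (of_real 1 * u) (of_real 1 * v)) (at 1 within {1/2..1})"
    unfolding continuous_on_def by (rule bspec) simp
  also have "at 1 within {1/2..1::real} = at_left 1"
    by (rule at_within_Icc_at_left) simp
  finally show ?thesis by simp
qed

lemma abel_series_tendsto:
  assumes "x \<in> slit_plane" "(f \<longlongrightarrow> u) F" "(g \<longlongrightarrow> v) F"
    and "norm u \<le> 1" "norm v \<le> 1" "v \<noteq> 1"
    and "eventually (\<lambda>r. norm (f r) < 1 \<and> norm (g r) < 1) F"
  shows "((\<lambda>r. abel_series x (f r) (g r)) \<longlongrightarrow> abel_series x u v) F"
proof -
  have "((\<lambda>r. (f r, g r)) \<longlongrightarrow> (u, v)) F" by (intro tendsto_Pair assms)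
  moreover have "eventually (\<lambda>r. (f r, g r) \<in> cball 0 1 \<times> (cball 0 1 - {1})) F"
    using assms(7) by eventually_elim auto
  ultimately show ?thesis
    using continuous_on_tendsto_compose[OF continuous_on_abel_series[OF assms(1)], of "\<lambda>r. (f r, g r)" "(u, v)" F]
      assms(4-6) by simp
qed

lemma eventually_scaled_norm_less_1:
  fixes u v :: complex
  assumes "norm u \<le> 1" "norm v \<le> 1"
  shows "eventually (\<lambda>r. 0 < r \<and> norm (of_real r * u) < 1 \<and> norm (of_real r * v) < 1) (at_left 1)"
proof -
  have *: "norm (of_real r * w) < 1" if "0 < r" "r < 1" "norm w \<le> 1" for r :: real and w :: complex
  proof -
    have "norm (of_real r * w) = r * norm w" using that by (simp add: norm_mult)
    also have "\<dots> \<le> r * 1" using that by (intro mult_left_mono) auto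
    finally show ?thesis using that by simp
  qed
  have "eventually (\<lambda>r::real. 0 < r \<and> r < 1) (at_left 1)"
    using eventually_at_left_real[of 0 1] by (simp add: greaterThanLessThan_def)
  then show ?thesis
  proof eventually_elim
    case (elim r)
    then show ?case using *[of r u] *[of r v] assms by blast
  qed
qed

lemma scaled_tendsto: "((\<lambda>r. of_real r * u) \<longlongrightarrow> (u :: complex)) (at_left 1)"
proof -
  have "((\<lambda>r. of_real r * u) \<longlongrightarrow> of_real 1 * u) (at_left 1)" by (intro tendsto_intros)
  then show ?thesis by simp
qed

text \<open>
  Both sides are radially continuous, and they agree inside the open bidisc.
\<close>

lemma HZN_integral_eq_abel_series:
  assumes x: "Re x > 0" and u: "u \<in> punctured_disc'" and v: "v \<in> punctured_disc'"
  shows "HZN_integral x u v = abel_series x u v"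
proof -
  have u': "norm u \<le> 1" and v': "norm v \<le> 1" "v \<noteq> 1" "v \<noteq> 0"
    using u v by (auto simp: punctured_disc'_def punctured_disc_def)
  have x': "x \<in> slit_plane" using x right_half_plane_subset_slit_plane by auto
  note ev = eventually_scaled_norm_less_1[OF u' v'(1)]
  have "((\<lambda>r. abel_series x (of_real r * u) (of_real r * v)) \<longlongrightarrow> abel_series x u v) (at_left 1)"
    by (rule abel_series_tendsto[OF x' scaled_tendsto scaled_tendsto u' v'(1,2)])
       (use ev in \<open>auto elim: eventually_mono\<close>)
  moreover have "eventually (\<lambda>r. abel_series x (of_real r * u) (of_real r * v) =
      HZN_integral x (of_real r * u) (of_real r * v)) (at_left 1)"
    using ev
  proof eventually_elim
    case (elim r)
    then show ?case
      using HZN_integral_eq_double_series[OF x, of "of_real r * u" "of_real r * v"] v'(3)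
        abel_series_eq_double_series[OF x', of "of_real r * u" "of_real r * v"] by simp
  qed
  ultimately have "((\<lambda>r. HZN_integral x (of_real r * u) (of_real r * v)) \<longlongrightarrow> abel_series x u v) (at_left 1)"
    by (rule Lim_transform_eventually)
  then show ?thesis
    by (rule tendsto_unique[OF trivial_limit_at_left_real HZN_integral_radial_limit[OF x u v]])
qed

lemma HZN_eq_abel_series:
  assumes "x \<in> slit_plane" "u \<in> punctured_disc'" "v \<in> punctured_disc'"
  shows "HZN x u v = abel_series x u v"
  unfolding HZN_def
proof (rule continuation_eq)
  show "(\<lambda>x. abel_series x u v) holomorphic_on slit_plane"
    by (rule holomorphic_on_abel_series) (use assms in \<open>auto simp: punctured_disc'_def punctured_disc_def\<close>)
  show "abel_series z u v = HZN_integral z u v" if "z \<in> {x. Re x > 0}" for z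
    using HZN_integral_eq_abel_series[of z u v] that assms by simp
  show "{x :: complex. Re x > 0} \<noteq> {}" by (auto intro: exI[of _ 1])
qed (use assms open_slit_plane connected_slit_plane right_half_plane_subset_slit_plane
       in \<open>auto simp: open_halfspace_Re_gt\<close>)

text \<open>
  The primitive \<open>\<Phi>\<close> comes from integrating \<open>ln (1 - t u)\<close> against the derivative of
  \<open>- ln (1 - t u v)\<close> by parts and substituting \<open>y = 1 - t u\<close>, under which
  \<open>1 - t u v = (1 - v) (1 + v y / (1 - v))\<close>.
\<close>

lemma HZN_integral_at_1:
  assumes u: "norm u \<le> 1" "u \<noteq> 1" and v: "norm v \<le> 1" "v \<noteq> 1"
    and uv: "u * v \<noteq> 0" "u * v \<noteq> 1"
  shows "HZN_integral 1 u (u * v) =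
    Li2 (v / (v - 1)) - Li2 (v * (1 - u) / (v - 1)) + ln (1 - u) * ln (1 - v) - ln (1 - u) * ln (1 - u * v)"
proof -
  define \<Phi> where "\<Phi> = (\<lambda>t. - ln (1 - t * u) * ln (1 - t * (u * v)) + ln (1 - v) * ln (1 - t * u)
    - Li2 (v * (1 - t * u) / (v - 1)))"
  have nuv: "norm (u * v) \<le> 1" using u(1) v(1) by (simp add: norm_mult mult_le_one)
  have posv: "Re (1 - v) > 0" using v by (rule Re_one_minus_pos)
  then have v0: "1 - v \<noteq> 0" "v - 1 \<noteq> 0" using v by auto
  have arg: "1 - v * (1 - z * u) / (v - 1) = (1 - z * (u * v)) / (1 - v)" for z
    using v0 by (simp add: divide_simps) (simp add: algebra_simps)
  have "((\<lambda>t. u * v / (1 - of_real t * (u * v)) * ln (1 - of_real t * u)) has_integral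
      \<Phi> (of_real 1) - \<Phi> (of_real 0)) {0..1}"
  proof (rule fundamental_theorem_of_calculus)
    fix t :: real
    assume t: "t \<in> {0..1}"
    define z where "z = complex_of_real t"
    have pos: "Re (1 - z * u) > 0" "Re (1 - z * (u * v)) > 0"
      using t Re_one_minus_scaled_pos[OF u, of t] Re_one_minus_scaled_pos[OF nuv uv(2), of t]
      by (auto simp: z_def)
    note ne = Re_pos_imp_nonzero[OF pos(1)] Re_pos_imp_nonzero[OF pos(2)]
    define b w where "b = u / (1 - z * u)" and "w = u * v / (1 - z * (u * v))"
    define U W V where "U = ln (1 - z * u)" and "W = ln (1 - z * (u * v))" and "V = ln (1 - v)"
    have dU: "((\<lambda>z. ln (1 - z * u)) has_field_derivative - b) (at z)"
      and dW: "((\<lambda>z. ln (1 - z * (u * v))) has_field_derivative - w) (at z)"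
      using pos ne unfolding b_def w_def
      by (auto intro!: derivative_eq_intros simp: complex_nonpos_Reals_iff divide_simps
            simp del: minus_complex.simps times_complex.simps)
    have "((\<lambda>z. v * (1 - z * u) / (v - 1)) has_field_derivative
        v * (1 - z * u) / (v - 1) * (- b)) (at z)"
      unfolding b_def using ne v0
      by (auto intro!: derivative_eq_intros simp: divide_simps)
    from Li2_chain[OF this]
    have "((\<lambda>z. Li2 (v * (1 - z * u) / (v - 1))) has_field_derivative
        - ln ((1 - z * (u * v)) / (1 - v)) * (- b)) (at z)"
      unfolding arg using Re_divide_pos_in_slit_plane[OF pos(2) posv] by simp
    also have "ln ((1 - z * (u * v)) / (1 - v)) = W - V"
      unfolding W_def V_def by (rule Ln_divide_Re_pos[OF pos(2) posv])
    finally have dL: "((\<lambda>z. Li2 (v * (1 - z * u) / (v - 1))) has_field_derivative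
        - (W - V) * (- b)) (at z)" .
    have "(\<Phi> has_field_derivative
        (- (- b)) * W + (- w) * (- U) + V * (- b) - - (W - V) * (- b)) (at z)"
      unfolding \<Phi>_def U_def W_def V_def
      by (intro DERIV_diff DERIV_add DERIV_mult DERIV_minus DERIV_cmult dU dW dL[unfolded W_def V_def])
    also have "(- (- b)) * W + (- w) * (- U) + V * (- b) - - (W - V) * (- b) = w * U"
      by (simp add: algebra_simps)
    finally show "((\<lambda>t. \<Phi> (of_real t)) has_vector_derivative
        u * v / (1 - of_real t * (u * v)) * ln (1 - of_real t * u)) (at t within {0..1})"
      unfolding z_def w_def U_def
      by (intro has_vector_derivative_real_field[THEN has_vector_derivative_at_within])
  qed simp
  then have "((\<lambda>t. ln (1 - u * of_real t powr 1) / (inverse (u * v) - of_real t)) has_integral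
      \<Phi> (of_real 1) - \<Phi> (of_real 0)) {0..1}"
    unfolding HZN_integrand_eq[OF uv(1)]
    by (rule has_integral_eq[rotated]) (simp add: mult_ac)
  then show ?thesis
    unfolding HZN_integral_def by (simp add: integral_unique \<Phi>_def algebra_simps)
qed

section \<open>Functional equations\<close>

lemma punctured_disc'_iff: "u \<in> punctured_disc' \<longleftrightarrow> u \<noteq> 0 \<and> norm u \<le> 1 \<and> u \<noteq> 1"
  by (auto simp: punctured_disc'_def punctured_disc_def)

lemma HZN_reflection:
  assumes x: "x \<in> slit_plane" and u: "u \<in> punctured_disc'" and v: "v \<in> punctured_disc'"
  shows "HZN x u v + HZN (1 / x) v u = - ln (1 - u) * ln (1 - v)"
proof -
  have u': "norm u \<le> 1" "u \<noteq> 1" and v': "norm v \<le> 1" "v \<noteq> 1"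
    using u v by (auto simp: punctured_disc'_iff)
  have x': "1 / x \<in> slit_plane" using slit_plane_inverse[OF x] by (simp add: inverse_eq_divide)
  note ev = eventually_scaled_norm_less_1[OF u'(1) v'(1)]
  have "((\<lambda>r. abel_series x (of_real r * u) (of_real r * v) + abel_series (1 / x) (of_real r * v) (of_real r * u))
      \<longlongrightarrow> abel_series x u v + abel_series (1 / x) v u) (at_left 1)"
    by (intro tendsto_add abel_series_tendsto x x' scaled_tendsto u' v')
       (use ev in \<open>auto elim: eventually_mono\<close>)
  moreover have "eventually (\<lambda>r. abel_series x (of_real r * u) (of_real r * v)
      + abel_series (1 / x) (of_real r * v) (of_real r * u)
      = - ln (1 - of_real r * u) * ln (1 - of_real r * v)) (at_left 1)"
    using ev
  proof eventually_elim
    case (elim r)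
    then have n: "norm (of_real r * u) < 1" "norm (of_real r * v) < 1" by blast+
    have "- a + - b = - c * d" if "a + b = c * d" for a b c d :: complex
      using that by (metis minus_add_distrib mult_minus_left)
    from this[OF double_series_reflection[OF x n]] show ?case
      by (simp only: abel_series_eq_double_series x x' n)
  qed
  ultimately have "((\<lambda>r. - ln (1 - of_real r * u) * ln (1 - of_real r * v))
      \<longlongrightarrow> abel_series x u v + abel_series (1 / x) v u) (at_left 1)"
    by (rule Lim_transform_eventually)
  moreover have "((\<lambda>r. - ln (1 - of_real r * u) * ln (1 - of_real r * v))
      \<longlongrightarrow> - ln (1 - u) * ln (1 - v)) (at_left 1)"
    using Re_one_minus_pos[OF u'] Re_one_minus_pos[OF v']
    by (intro tendsto_intros scaled_tendsto) (auto simp: complex_nonpos_Reals_iff)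
  ultimately have "abel_series x u v + abel_series (1 / x) v u = - ln (1 - u) * ln (1 - v)"
    by (rule tendsto_unique[OF trivial_limit_at_left_real])
  then show ?thesis
    by (simp only: HZN_eq_abel_series[OF x u v] HZN_eq_abel_series[OF x' v u])
qed

text \<open>
  The term \<open>HZN_integral 1 u (u * v)\<close> takes the place of minus the double series at
  \<open>(1; u, u v)\<close>, which need not converge absolutely on the boundary.
\<close>

lemma HZN_three_term:
  assumes x: "x \<in> slit_plane"
    and u: "u \<in> punctured_disc'" and v: "v \<in> punctured_disc'" and uv: "u * v \<in> punctured_disc'"
  shows "HZN x u v - HZN (x + 1) (u * v) v - HZN (x / (x + 1)) u (u * v)
    = - Li2 (u * v) / (x + 1) - HZN_integral 1 u (u * v)"
proof -
  note x1 = slit_plane_add_1[OF x] and x2 = slit_plane_moebius[OF x]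
  have one: "1 \<in> slit_plane" by (simp add: slit_plane_iff)
  have x1_nz: "x + 1 \<noteq> 0" using x1 by (auto simp: slit_plane_iff)
  have u': "norm u \<le> 1" and v': "norm v \<le> 1" "v \<noteq> 1" and uv': "norm (u * v) \<le> 1" "u * v \<noteq> 1"
    using u v uv by (auto simp: punctured_disc'_iff)
  let ?u = "\<lambda>r. complex_of_real r * u" and ?v = "\<lambda>r. complex_of_real r * v"
  have ev: "eventually (\<lambda>r. norm (?u r) < 1 \<and> norm (?v r) < 1 \<and> norm (?u r * ?v r) < 1) (at_left 1)"
    using eventually_scaled_norm_less_1[OF u' v'(1)]
  proof eventually_elim
    case (elim r)
    then show ?case using norm_mult_less[of "?u r" 1 "?v r" 1] by simp
  qed
  have uv_lim: "((\<lambda>r. ?u r * ?v r) \<longlongrightarrow> u * v) (at_left 1)"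
    by (intro tendsto_mult scaled_tendsto)
  have Li2_lim: "((\<lambda>r. Li2 (?u r * ?v r)) \<longlongrightarrow> Li2 (u * v)) (at_left 1)"
    by (rule continuous_on_tendsto_compose[OF continuous_on_Li2_disc uv_lim])
       (use uv' ev in \<open>auto elim!: eventually_mono\<close>)
  have "((\<lambda>r. abel_series x (?u r) (?v r) - abel_series (x + 1) (?u r * ?v r) (?v r)
        - abel_series (x / (x + 1)) (?u r) (?u r * ?v r))
      \<longlongrightarrow> abel_series x u v - abel_series (x + 1) (u * v) v - abel_series (x / (x + 1)) u (u * v)) (at_left 1)"
    by (intro tendsto_diff abel_series_tendsto x x1 x2 scaled_tendsto uv_lim u' v' uv')
       (use ev in \<open>auto elim: eventually_mono\<close>)
  moreover have "eventually (\<lambda>r. abel_series x (?u r) (?v r) - abel_series (x + 1) (?u r * ?v r) (?v r)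
        - abel_series (x / (x + 1)) (?u r) (?u r * ?v r)
      = - Li2 (?u r * ?v r) / (x + 1) - abel_series 1 (?u r) (?u r * ?v r)) (at_left 1)"
    using ev
  proof eventually_elim
    case (elim r)
    then have n: "norm (?u r) < 1" "norm (?v r) < 1" "norm (?u r * ?v r) < 1" by blast+
    have "- a - - b - - c = - l - - d" if "a - b - c = l - d" for a b c d l :: complex
    proof -
      have "- a - - b - - c = - (a - b - c)" by simp
      also have "\<dots> = - l - - d" by (simp only: that) simp
      finally show ?thesis .
    qed
    from this[OF double_series_three_term[OF x n(1,2)]] show ?case
      by (simp only: abel_series_eq_double_series x x1 x2 one n minus_divide_left)
  qed
  ultimately have "((\<lambda>r. - Li2 (?u r * ?v r) / (x + 1) - abel_series 1 (?u r) (?u r * ?v r))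
      \<longlongrightarrow> abel_series x u v - abel_series (x + 1) (u * v) v - abel_series (x / (x + 1)) u (u * v)) (at_left 1)"
    by (rule Lim_transform_eventually)
  moreover have "((\<lambda>r. - Li2 (?u r * ?v r) / (x + 1) - abel_series 1 (?u r) (?u r * ?v r))
      \<longlongrightarrow> - Li2 (u * v) / (x + 1) - abel_series 1 u (u * v)) (at_left 1)"
    by (intro tendsto_diff tendsto_divide tendsto_minus tendsto_const Li2_lim x1_nz
          abel_series_tendsto one scaled_tendsto uv_lim u' uv')
       (use ev in \<open>auto elim: eventually_mono\<close>)
  ultimately have "abel_series x u v - abel_series (x + 1) (u * v) v - abel_series (x / (x + 1)) u (u * v)
      = - Li2 (u * v) / (x + 1) - abel_series 1 u (u * v)"
    by (rule tendsto_unique[OF trivial_limit_at_left_real])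
  moreover have "HZN_integral 1 u (u * v) = abel_series 1 u (u * v)"
    by (rule HZN_integral_eq_abel_series) (use u uv in auto)
  ultimately show ?thesis
    by (simp only: HZN_eq_abel_series[OF x u v] HZN_eq_abel_series[OF x1 uv v] HZN_eq_abel_series[OF x2 u uv])
qed

lemma HZN_three_term_dilog:
  assumes x: "x \<in> slit_plane"
    and u: "u \<in> punctured_disc'" and v: "v \<in> punctured_disc'" and uv: "u * v \<in> punctured_disc'"
    and s: "s\<^sup>2 = u * v"
  shows "HZN x u v - HZN (x + 1) (u * v) v - HZN (x / (x + 1)) u (u * v)
    = ln (1 - u) * ln (1 - u * v) + Li2 u - Li2 (v / (v - 1)) + 2 * Li2 (u / (u - 1))
      - Li2 ((u - v) / (1 - v)) - (1 / (x + 1) - 1 / 2) * Li2 (u * v)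
      - (Li2 ((u + s) / (u - 1)) + Li2 ((u - s) / (u - 1))
         - Li2 ((v + s) / (v - 1)) - Li2 ((v - s) / (v - 1)))"
proof -
  have u': "norm u \<le> 1" "u \<noteq> 1" and v': "norm v \<le> 1" "v \<noteq> 1" and uv': "u * v \<noteq> 0" "u * v \<noteq> 1"
    using u v uv by (auto simp: punctured_disc'_iff)
  have "HZN x u v - HZN (x + 1) (u * v) v - HZN (x / (x + 1)) u (u * v)
      = - Li2 (u * v) / (x + 1) + ln (1 - u) * ln (1 - u * v) - Li2 (v / (v - 1))
        + (Li2 (v * (1 - u) / (v - 1)) - ln (1 - u) * ln (1 - v))"
    unfolding HZN_three_term[OF x u v uv] HZN_integral_at_1[OF u' v' uv'] by simp
  then show ?thesis
    unfolding dilog_square_root_identity[OF u' v' s uv'(2)]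
    by (simp add: left_diff_distrib diff_divide_distrib)
qed

text \<open>
  On the circle \<open>v / (v - 1)\<close> has real part \<open>1 / 2\<close>, and replacing \<open>v\<close> by its inverse replaces
  it by its complement to 1.
\<close>

lemma Li2_reflection_on_circle:
  assumes "norm v = 1" "v \<noteq> 1"
  shows "Li2 (v / (v - 1)) + Li2 (inverse v / (inverse v - 1))
    = of_real (pi\<^sup>2 / 6) + ln (v / (v - 1)) * ln (1 - v)"
proof -
  have pos: "Re (1 - v) > 0" using assms by (intro Re_one_minus_pos) auto
  have nz: "v \<noteq> 0" "v - 1 \<noteq> 0" "1 - v \<noteq> 0" using assms by auto
  have "(Re v)\<^sup>2 + (Im v)\<^sup>2 = 1"
    using assms(1) by (simp add: cmod_def)
  then have "Re v * (Re v - 1) + Im v * Im v = 1 - Re v"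
    "(Re v - 1)\<^sup>2 + (Im v)\<^sup>2 = 2 * (1 - Re v)"
    by (simp_all add: power2_eq_square algebra_simps)
  then have "Re (v / (v - 1)) = (1 - Re v) / (2 * (1 - Re v))" by (simp add: Re_divide)
  then have Re_half: "Re (v / (v - 1)) = 1 / 2" using pos by simp
  have c: "1 - v / (v - 1) = 1 / (1 - v)" "inverse v / (inverse v - 1) = 1 / (1 - v)"
    using nz by (simp_all add: divide_simps)
  have "ln (1 / (1 - v)) = - ln (1 - v)"
    using Ln_divide_Re_pos[of 1 "1 - v"] pos by simp
  with Li2_reflection[of "v / (v - 1)"] Re_half show ?thesis by (simp add: c)
qed

lemma sum_signs:
  fixes f :: "complex \<Rightarrow> complex"
  shows "(\<Sum>j\<in>{1..2::nat}. f (exp (of_real pi * \<i> * of_nat j))) = f (-1) + f 1"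
proof -
  have "{1..2::nat} = {1, 2}" by auto
  moreover have "exp (of_real pi * \<i> * of_nat 1) = -1" by simp
  moreover have "exp (of_real pi * \<i> * of_nat 2) = 1"
    using exp_two_pi_i by (simp add: mult_ac)
  ultimately show ?thesis by simp
qed

theorem theorem2p3:
  fixes x :: complex
  assumes "x \<in> slit_plane"
  shows
    "(\<forall>u\<in>punctured_disc'. \<forall>v\<in>punctured_disc'.
        HZN x u v + HZN (1 / x) v u = - ln (1 - u) * ln (1 - v))
     \<and>
     (\<forall>u v s. u \<in> punctured_disc' \<and> v \<in> punctured_disc' \<and> u * v \<in> punctured_disc' \<and> s^2 = u * v \<longrightarrow>
        HZN x u v - HZN (x + 1) (u * v) v - HZN (x / (x + 1)) u (u * v)
        = ln (1 - u) * ln (1 - u * v) + Li2 u - Li2 (v / (v - 1)) + 2 * Li2 (u / (u - 1))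
          - Li2 ((u - v) / (1 - v)) - (1 / (x + 1) - 1 / 2) * Li2 (u * v)
          - (\<Sum>j\<in>{1..2::nat}.
               Li2 ((u + s * exp (of_real pi * \<i> * of_nat j)) / (u - 1))
               - Li2 ((v + s * exp (of_real pi * \<i> * of_nat j)) / (v - 1))))
     \<and>
     (\<forall>u v s p q. u \<in> unit_circle' \<and> v \<in> unit_circle' \<and> u * v \<noteq> 1
          \<and> s^2 = u * v \<and> p^2 = u * inverse v \<and> q^2 = v * inverse u \<longrightarrow>
        HZN x u v + HZN x (inverse u) (inverse v)
        - HZN (x + 1) (u * v) v - HZN (x + 1) (inverse (u * v)) (inverse v)
        - HZN (x / (x + 1)) u (u * v) - HZN (x / (x + 1)) (inverse u) (inverse (u * v))
        = ln (1 - u) * ln (1 - u * v) + ln (1 - inverse u) * ln (1 - inverse (u * v))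
          + 2 * ln (u / (u - 1)) * ln (1 - u) - 1 / 2 * (ln (- u))^2
          - ln (v / (v - 1)) * ln (1 - v)
          + (1 / (x + 1) - 1 / 2) * (1 / 2 * (ln (- (u * v)))^2 + of_real pi ^ 2 / 6)
          - Li2 ((u - v) / (1 - v)) - Li2 ((u - v) / (u * (1 - v)))
          - (\<Sum>j\<in>{1..2::nat}.
               Li2 ((u + s * exp (of_real pi * \<i> * of_nat j)) / (u - 1))
               - Li2 ((v + s * exp (of_real pi * \<i> * of_nat j)) / (v - 1))
               + Li2 ((1 + p * exp (of_real pi * \<i> * of_nat j)) / (1 - u))
               - Li2 ((1 + q * exp (of_real pi * \<i> * of_nat j)) / (1 - v))))"
proof (intro conjI ballI allI impI)
  fix u v
  assume "u \<in> punctured_disc'" "v \<in> punctured_disc'"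
  then show "HZN x u v + HZN (1 / x) v u = - ln (1 - u) * ln (1 - v)"
    by (rule HZN_reflection[OF assms])
next
  fix u v s
  assume *: "u \<in> punctured_disc' \<and> v \<in> punctured_disc' \<and> u * v \<in> punctured_disc' \<and> s\<^sup>2 = u * v"
  let ?f = "\<lambda>e. Li2 ((u + s * e) / (u - 1)) - Li2 ((v + s * e) / (v - 1))"
  have "HZN x u v - HZN (x + 1) (u * v) v - HZN (x / (x + 1)) u (u * v)
        = ln (1 - u) * ln (1 - u * v) + Li2 u - Li2 (v / (v - 1)) + 2 * Li2 (u / (u - 1))
          - Li2 ((u - v) / (1 - v)) - (1 / (x + 1) - 1 / 2) * Li2 (u * v)
          - (?f (- 1) + ?f 1)"
    by (subst HZN_three_term_dilog[OF assms, of u v s]) (use * in auto)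
  then show "HZN x u v - HZN (x + 1) (u * v) v - HZN (x / (x + 1)) u (u * v)
        = ln (1 - u) * ln (1 - u * v) + Li2 u - Li2 (v / (v - 1)) + 2 * Li2 (u / (u - 1))
          - Li2 ((u - v) / (1 - v)) - (1 / (x + 1) - 1 / 2) * Li2 (u * v)
          - (\<Sum>j\<in>{1..2::nat}.
               Li2 ((u + s * exp (of_real pi * \<i> * of_nat j)) / (u - 1))
               - Li2 ((v + s * exp (of_real pi * \<i> * of_nat j)) / (v - 1)))"
    by (simp only: sum_signs[of ?f])
next
  fix u v s p q
  assume "u \<in> unit_circle' \<and> v \<in> unit_circle' \<and> u * v \<noteq> 1
          \<and> s\<^sup>2 = u * v \<and> p\<^sup>2 = u * inverse v \<and> q\<^sup>2 = v * inverse u"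
  then have u: "norm u = 1" "u \<noteq> 1" and v: "norm v = 1" "v \<noteq> 1" and uv: "u * v \<noteq> 1"
    and s: "s\<^sup>2 = u * v" and p: "p\<^sup>2 = u * inverse v" and q: "q\<^sup>2 = v * inverse u"
    by (auto simp: unit_circle'_def unit_circle_def)
  have nz: "u \<noteq> 0" "v \<noteq> 0" "1 - u \<noteq> 0" "1 - v \<noteq> 0" using u v by auto
  have inv: "inverse u * inverse v = inverse (u * v)" by simp
  define k where "k = 1 / (x + 1) - 1 / 2"
  have A: "HZN x u v - HZN (x + 1) (u * v) v - HZN (x / (x + 1)) u (u * v)
    = ln (1 - u) * ln (1 - u * v) + Li2 u - Li2 (v / (v - 1)) + 2 * Li2 (u / (u - 1))
      - Li2 ((u - v) / (1 - v)) - k * Li2 (u * v)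
      - (Li2 ((u + s) / (u - 1)) + Li2 ((u - s) / (u - 1))
         - Li2 ((v + s) / (v - 1)) - Li2 ((v - s) / (v - 1)))"
    unfolding k_def using u v uv nz
    by (intro HZN_three_term_dilog assms s) (auto simp: punctured_disc'_iff norm_mult)
  have "HZN x (inverse u) (inverse v) - HZN (x + 1) (inverse u * inverse v) (inverse v)
      - HZN (x / (x + 1)) (inverse u) (inverse u * inverse v)
    = ln (1 - inverse u) * ln (1 - inverse u * inverse v) + Li2 (inverse u)
      - Li2 (inverse v / (inverse v - 1)) + 2 * Li2 (inverse u / (inverse u - 1))
      - Li2 ((inverse u - inverse v) / (1 - inverse v)) - k * Li2 (inverse u * inverse v)
      - (Li2 ((inverse u + p / u) / (inverse u - 1)) + Li2 ((inverse u - p / u) / (inverse u - 1))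
         - Li2 ((inverse v + p / u) / (inverse v - 1)) - Li2 ((inverse v - p / u) / (inverse v - 1)))"
    unfolding k_def
  proof (intro HZN_three_term_dilog assms)
    (* p^2 = u / v, so p / u is a square root of 1 / (u v) *)
    show "(p / u)\<^sup>2 = inverse u * inverse v"
      using nz by (simp add: power_divide p) (simp add: field_simps power2_eq_square)
    have "inverse (u * v) \<noteq> 1" using uv by (metis inverse_1 inverse_inverse_eq)
    then show "inverse u * inverse v \<in> punctured_disc'"
      using u v nz by (simp add: punctured_disc'_iff norm_mult norm_inverse)
  qed (use u v nz in \<open>auto simp: punctured_disc'_iff norm_inverse\<close>)
  moreover have "(inverse u - inverse v) / (1 - inverse v) = (u - v) / (u * (1 - v))"
    "(inverse u + p / u) / (inverse u - 1) = (1 + p) / (1 - u)"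
    "(inverse u - p / u) / (inverse u - 1) = (1 - p) / (1 - u)"
    "(inverse v + p / u) / (inverse v - 1) = (1 + p * v / u) / (1 - v)"
    "(inverse v - p / u) / (inverse v - 1) = (1 - p * v / u) / (1 - v)"
  proof -
    have *: "inverse w * a / (inverse w * b) = a / b" if "w \<noteq> 0" for w a b :: complex
      using that by simp
    have i: "inverse w - 1 = inverse w * (1 - w)" if "w \<noteq> 0" for w :: complex
      using that by (simp add: right_diff_distrib)
    have "inverse u + p / u = inverse u * (1 + p)" "inverse u - p / u = inverse u * (1 - p)"
      by (simp_all add: divide_inverse algebra_simps)
    moreover have "inverse v + p / u = inverse v * (1 + p * v / u)"
      "inverse v - p / u = inverse v * (1 - p * v / u)"
      using nz by (simp_all add: field_simps)
    ultimately show "(inverse u + p / u) / (inverse u - 1) = (1 + p) / (1 - u)"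
      "(inverse u - p / u) / (inverse u - 1) = (1 - p) / (1 - u)"
      "(inverse v + p / u) / (inverse v - 1) = (1 + p * v / u) / (1 - v)"
      "(inverse v - p / u) / (inverse v - 1) = (1 - p * v / u) / (1 - v)"
      by (simp_all only: i[OF nz(1)] i[OF nz(2)] *[OF nz(1)] *[OF nz(2)])
    have "1 - inverse v = inverse v * (v - 1)" "inverse u - inverse v = inverse v * ((v - u) / u)"
      using nz by (simp_all add: field_simps)
    then have "(inverse u - inverse v) / (1 - inverse v) = (v - u) / u / (v - 1)"
      by (simp only: *[OF nz(2)])
    also have "\<dots> = (u - v) / (u * (1 - v))"
      using nz by (simp add: divide_simps) (simp add: algebra_simps)
    finally show "(inverse u - inverse v) / (1 - inverse v) = (u - v) / (u * (1 - v))" .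
  qed
  moreover have "Li2 ((1 + p * v / u) / (1 - v)) + Li2 ((1 - p * v / u) / (1 - v))
      = Li2 ((1 + q) / (1 - v)) + Li2 ((1 - q) / (1 - v))"
  proof -
    (* p v / u and q are square roots of the same number, and the sum does not depend on the sign *)
    have "(p * v / u)\<^sup>2 = q\<^sup>2"
      using nz by (simp add: power_divide power_mult_distrib p q) (simp add: field_simps power2_eq_square)
    then consider "p * v / u = q" | "p * v / u = - q" using power2_eq_iff by blast
    then show ?thesis by cases (simp_all only: diff_minus_eq_add add.commute diff_conv_add_uminus minus_minus)
  qed
  ultimately have B: "HZN x (inverse u) (inverse v) - HZN (x + 1) (inverse (u * v)) (inverse v)
      - HZN (x / (x + 1)) (inverse u) (inverse (u * v))
    = ln (1 - inverse u) * ln (1 - inverse (u * v)) + Li2 (inverse u)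
      - Li2 (inverse v / (inverse v - 1)) + 2 * Li2 (inverse u / (inverse u - 1))
      - Li2 ((u - v) / (u * (1 - v))) - k * Li2 (inverse (u * v))
      - (Li2 ((1 + p) / (1 - u)) + Li2 ((1 - p) / (1 - u))
         - (Li2 ((1 + q) / (1 - v)) + Li2 ((1 - q) / (1 - v))))"
    by (simp only: inv diff_diff_eq)
  let ?c = "complex_of_real (pi\<^sup>2 / 6)"
  have n_uv: "norm (u * v) = 1" using u v by (simp add: norm_mult)
  have i_u: "Li2 (inverse u) = - ?c - (ln (- u))\<^sup>2 / 2 - Li2 u"
    and i_uv: "Li2 (inverse (u * v)) = - ?c - (ln (- (u * v)))\<^sup>2 / 2 - Li2 (u * v)"
    using Li2_inversion_on_circle[OF u] Li2_inversion_on_circle[OF n_uv uv]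
    by (simp_all only: eq_diff_eq add.commute)
  have r_u: "Li2 (inverse u / (inverse u - 1)) = ?c + ln (u / (u - 1)) * ln (1 - u) - Li2 (u / (u - 1))"
    and r_v: "Li2 (inverse v / (inverse v - 1)) = ?c + ln (v / (v - 1)) * ln (1 - v) - Li2 (v / (v - 1))"
    using Li2_reflection_on_circle[OF u] Li2_reflection_on_circle[OF v]
    by (simp_all only: eq_diff_eq add.commute)
  have c: "of_real pi ^ 2 / 6 = ?c" by simp
  let ?f = "\<lambda>e. Li2 ((u + s * e) / (u - 1)) - Li2 ((v + s * e) / (v - 1))
               + Li2 ((1 + p * e) / (1 - u)) - Li2 ((1 + q * e) / (1 - v))"
  have f: "?f (- 1) + ?f 1 = Li2 ((u + s) / (u - 1)) + Li2 ((u - s) / (u - 1))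
         - Li2 ((v + s) / (v - 1)) - Li2 ((v - s) / (v - 1))
         + (Li2 ((1 + p) / (1 - u)) + Li2 ((1 - p) / (1 - u))
         - (Li2 ((1 + q) / (1 - v)) + Li2 ((1 - q) / (1 - v))))"
    by simp
  (* the equation below is linear in the values of HZN and Li2; with these as variables e1, ..., e4
     cancel and c0, which stands for pi^2 / 6, survives only in the multiple of k *)
  have "a1 + b1 - a2 - b2 - a3 - b3 =
      l1 + l2 + 2 * l3 * l4 - 1 / 2 * l5 - l6 * l7 + k * (1 / 2 * l8 + c0) - d1 - d2 - (S + T)"
    if "a1 - a2 - a3 = l1 + e1 - e2 + 2 * e3 - d1 - k * e4 - S"
      "b1 - b2 - b3 = l2 + (- c0 - l5 / 2 - e1) - (c0 + l6 * l7 - e2) + 2 * (c0 + l3 * l4 - e3)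
        - d2 - k * (- c0 - l8 / 2 - e4) - T"
    for a1 a2 a3 b1 b2 b3 l1 l2 l3 l4 l5 l6 l7 l8 c0 d1 d2 S T e1 e2 e3 e4 :: complex
  proof -
    have "a1 + b1 - a2 - b2 - a3 - b3 = (a1 - a2 - a3) + (b1 - b2 - b3)" by simp
    then show ?thesis unfolding that by (simp add: algebra_simps)
  qed
  note combine = this
  show "HZN x u v + HZN x (inverse u) (inverse v)
        - HZN (x + 1) (u * v) v - HZN (x + 1) (inverse (u * v)) (inverse v)
        - HZN (x / (x + 1)) u (u * v) - HZN (x / (x + 1)) (inverse u) (inverse (u * v))
        = ln (1 - u) * ln (1 - u * v) + ln (1 - inverse u) * ln (1 - inverse (u * v))
          + 2 * ln (u / (u - 1)) * ln (1 - u) - 1 / 2 * (ln (- u))^2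
          - ln (v / (v - 1)) * ln (1 - v)
          + (1 / (x + 1) - 1 / 2) * (1 / 2 * (ln (- (u * v)))^2 + of_real pi ^ 2 / 6)
          - Li2 ((u - v) / (1 - v)) - Li2 ((u - v) / (u * (1 - v)))
          - (\<Sum>j\<in>{1..2::nat}.
               Li2 ((u + s * exp (of_real pi * \<i> * of_nat j)) / (u - 1))
               - Li2 ((v + s * exp (of_real pi * \<i> * of_nat j)) / (v - 1))
               + Li2 ((1 + p * exp (of_real pi * \<i> * of_nat j)) / (1 - u))
               - Li2 ((1 + q * exp (of_real pi * \<i> * of_nat j)) / (1 - v)))"
    unfolding sum_signs[of ?f] f c k_def[symmetric]
    by (rule combine[OF A B[unfolded i_u i_uv r_u r_v]])
qed

end
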